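(* Let $M\ge 1$ and $R\ge 0$ be integers, and consider any $(M,R)$-cheap talk game with $m=1$ good (with arbitrary finite sets of buyer types and seller types and arbitrary independent, commonly known type distributions). For every subgame-perfect Bayes-Nash equilibrium $E$ of this game, possibly in mixed strategies, there exists a subgame-perfect Bayes-Nash equilibrium $E'$ of the same game that is interim payoff-equivalent to $E$ and in which every message is uninformative.
   Context: **Setting (one good).** There are a seller, a buyer and a single good. There are $n$ possible buyer types $i\in[n]=\{1,\dots,n\}$ with values $v^i\in\mathbb{R}_{\ge 0}$, and $\ell$ possible seller types $k\in[\ell]$ with costs $c^k\in\mathbb{R}_{\ge 0}$. The buyer's type and the seller's type are drawn independently from commonly known distributions on $[n]$ and $[\ell]$ (each listed type having positive probability). **The $(M,R)$-cheap talk game with $m=1$ good.** 1. The buyer privately observes his type $i$ (equivalently $v^i$). 2. The seller privately observes her type $k$ and cost $c^k$. 3. There are $R$ rounds of cheap talk, indexed backwards: $r=R,R-1,\dots,1$. In round $r$, if $r$ is even the seller publicly chooses a message in $[M]$; if $r$ is odd the buyer publicly chooses a message in $[M]$. (So if $R\geq 1$ the buyer sends the last message.) 4. The seller posts a single price $p\in\mathbb{R}_{\ge 0}\cup\{\infty\}$ ($p=\infty$ represents refusing to sell). 5. The buyer decides whether to buy. If he does not buy, both payoffs are $0$. If he buys at (finite) price $p$, the buyer's payoff is $v^i-p$ and the seller's payoff is $p-c^k$. The buyer never buys at price $\infty$. Players are risk-neutral expected-payoff maximizers. **Equilibrium.** A subgame-perfect Bayes-Nash equilibrium consists of (possibly mixed,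 type-dependent) strategies for both players, together with, for each public history, beliefs of each player about the other's type, such that (sequential rationality) after every history, each type of each player has no profitable deviation in the continuation given the player's beliefs and the other player's strategy, and (Bayesian consistency) beliefs are obtained from the prior by Bayes' rule along the history of messages whenever Bayes' rule applies. **Interim payoff-equivalence.** Two equilibria are interim payoff-equivalent if, for each buyer type $i\in[n]$, the expected payoff of the buyer conditional on having type $i$ is the same in both, and, for each seller type $k\in[\ell]$, the expected payoff of the seller conditional on having type $k$ is the same in both. **Uninformative message.** A message is uninformative in an equilibrium if it does not change the other player's beliefs, i.e. the receiver's belief about the sender's type after the message is the same as before it. *)

theory Defs
  imports "HOL-Probability.Probability"
begin

text \<open>
  Buyer types and seller types are the elements of two arbitrary finite types \<open>'b\<close> and \<open>'s\<close>.
  A message history is the chronological list of the messages sent so far, so after the history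
  \<open>h\<close> there are \<open>R - length h\<close> rounds left and the next round, in the backward indexing of the
  game, is round \<open>R - length h\<close>.  Prices live in \<^typ>\<open>ennreal\<close>, whose top element is the
  refusal to sell.
\<close>

definition histories :: "nat \<Rightarrow> nat \<Rightarrow> nat list set" where
  "histories M R = {h. length h \<le> R \<and> set h \<subseteq> {1..M}}"

definition seller_turn :: "nat \<Rightarrow> nat list \<Rightarrow> bool" where
  "seller_turn R h \<longleftrightarrow> length h < R \<and> even (R - length h)"

definition buyer_turn :: "nat \<Rightarrow> nat list \<Rightarrow> bool" where
  "buyer_turn R h \<longleftrightarrow> length h < R \<and> odd (R - length h)"


subsection \<open>Strategies\<close>

text \<open>
  Behavioural strategies of one type of a player.  \<open>accept b h p\<close> is the probability of buying
  at price \<open>p\<close> after the message history \<open>h\<close>.  The posted price may have an arbitrary Borel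
  distribution on \<open>[0, \<infinity>]\<close>.
\<close>

record buyer_strategy =
  buyer_msg :: "nat list \<Rightarrow> nat pmf"
  accept :: "nat list \<Rightarrow> ennreal \<Rightarrow> real"

record seller_strategy =
  seller_msg :: "nat list \<Rightarrow> nat pmf"
  post :: "nat list \<Rightarrow> ennreal measure"

definition is_buyer_strategy :: "nat \<Rightarrow> nat \<Rightarrow> buyer_strategy \<Rightarrow> bool" where
  "is_buyer_strategy M R b \<longleftrightarrow>
     (\<forall>h\<in>histories M R. buyer_turn R h \<longrightarrow> set_pmf (buyer_msg b h) \<subseteq> {1..M}) \<and>
     (\<forall>h\<in>histories M R. length h = R \<longrightarrow>
        accept b h \<in> borel_measurable borel \<and>
        (\<forall>p. 0 \<le> accept b h p \<and> accept b h p \<le> 1) \<and>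
        accept b h \<infinity> = 0)"

definition is_seller_strategy :: "nat \<Rightarrow> nat \<Rightarrow> seller_strategy \<Rightarrow> bool" where
  "is_seller_strategy M R s \<longleftrightarrow>
     (\<forall>h\<in>histories M R. seller_turn R h \<longrightarrow> set_pmf (seller_msg s h) \<subseteq> {1..M}) \<and>
     (\<forall>h\<in>histories M R. length h = R \<longrightarrow>
        prob_space (post s h) \<and> sets (post s h) = sets borel)"


subsection \<open>Payoffs\<close>

text \<open>
  Distribution of the complete message history when \<open>r\<close> rounds remain after \<open>h\<close>.
\<close>

primrec talk :: "nat \<Rightarrow> buyer_strategy \<Rightarrow> seller_strategy \<Rightarrow> nat list \<Rightarrow> nat list pmf" where
  "talk 0 b s h = return_pmf h"
| "talk (Suc r) b s h =
     bind_pmf (if even (Suc r) then seller_msg s h else buyer_msg b h)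
       (\<lambda>m. talk r b s (h @ [m]))"

text \<open>
  Expected continuation payoffs after the message history \<open>h\<close>, for given types with values
  \<open>x\<close> and \<open>y\<close> following \<open>b\<close> and \<open>s\<close>.  Since \<open>accept b h' \<infinity> = 0\<close>, the junk value
  \<open>enn2real \<infinity> = 0\<close> does not matter.  The Bochner integral is \<open>0\<close> for non-integrable
  functions; this does not affect the equilibria defined below, because there the buyer accepts
  no price above his value.  Hence every seller deviation has a bounded integrand, as has the
  buyer's equilibrium play.  A buyer deviation with a non-integrable loss is credited \<open>0\<close>, which
  he can also secure by refusing every price.
\<close>

definition buyer_cont_payoff ::
  "nat \<Rightarrow> real \<Rightarrow> buyer_strategy \<Rightarrow> seller_strategy \<Rightarrow> nat list \<Rightarrow> real" where
  "buyer_cont_payoff R x b s h =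
     measure_pmf.expectation (talk (R - length h) b s h)
       (\<lambda>h'. \<integral>p. accept b h' p * (x - enn2real p) \<partial>post s h')"

definition seller_cont_payoff ::
  "nat \<Rightarrow> real \<Rightarrow> buyer_strategy \<Rightarrow> seller_strategy \<Rightarrow> nat list \<Rightarrow> real" where
  "seller_cont_payoff R y b s h =
     measure_pmf.expectation (talk (R - length h) b s h)
       (\<lambda>h'. \<integral>p. accept b h' p * (enn2real p - y) \<partial>post s h')"

definition buyer_value ::
  "nat \<Rightarrow> real \<Rightarrow> 's pmf \<Rightarrow> buyer_strategy \<Rightarrow> ('s \<Rightarrow> seller_strategy) \<Rightarrow> nat list \<Rightarrow> real" where
  "buyer_value R x q b S h =
     measure_pmf.expectation q (\<lambda>k. buyer_cont_payoff R x b (S k) h)"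

definition seller_value ::
  "nat \<Rightarrow> real \<Rightarrow> 'b pmf \<Rightarrow> ('b \<Rightarrow> buyer_strategy) \<Rightarrow> seller_strategy \<Rightarrow> nat list \<Rightarrow> real" where
  "seller_value R y q B s h =
     measure_pmf.expectation q (\<lambda>i. seller_cont_payoff R y (B i) s h)"


subsection \<open>Equilibrium\<close>

text \<open>
  \<open>buyer_belief\<close> is the buyer's belief about the seller's type, \<open>seller_belief\<close> the seller's
  belief about the buyer's type.  No beliefs are recorded after a posted price: the buyer is then
  the only player left to move, and his payoff does not depend on the seller's type.
\<close>

record ('b, 's) assessment =
  buyer_strat :: "'b \<Rightarrow> buyer_strategy"
  seller_strat :: "'s \<Rightarrow> seller_strategy"
  buyer_belief :: "nat list \<Rightarrow> 's pmf"
  seller_belief :: "nat list \<Rightarrow> 'b pmf"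

text \<open>
  \<open>q'\<close> is the Bayesian update of \<open>q\<close> after a message that type \<open>t\<close> sends with probability
  \<open>L t\<close>; if the message has probability \<open>0\<close> under \<open>q\<close>, then \<open>q'\<close> is unrestricted.
\<close>

definition bayes_update :: "'t::finite pmf \<Rightarrow> ('t \<Rightarrow> real) \<Rightarrow> 't pmf \<Rightarrow> bool" where
  "bayes_update q L q' \<longleftrightarrow>
     ((\<Sum>t\<in>UNIV. pmf q t * L t) > 0 \<longrightarrow>
      (\<forall>t. pmf q' t = pmf q t * L t / (\<Sum>t'\<in>UNIV. pmf q t' * L t')))"

text \<open>
  Bayes' rule is applied message by message, also after histories that are themselves reached
  with probability \<open>0\<close>.  A message of one player carries no information about the type of the
  other one (types are independent), so the sender's own belief is unchanged.
\<close>

definition bayes_consistent ::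
  "nat \<Rightarrow> nat \<Rightarrow> 'b::finite pmf \<Rightarrow> 's::finite pmf \<Rightarrow> ('b, 's) assessment \<Rightarrow> bool" where
  "bayes_consistent M R \<mu> \<nu> E \<longleftrightarrow>
     seller_belief E [] = \<mu> \<and> buyer_belief E [] = \<nu> \<and>
     (\<forall>h\<in>histories M R. \<forall>m\<in>{1..M}.
        (seller_turn R h \<longrightarrow>
           seller_belief E (h @ [m]) = seller_belief E h \<and>
           bayes_update (buyer_belief E h) (\<lambda>k. pmf (seller_msg (seller_strat E k) h) m)
             (buyer_belief E (h @ [m]))) \<and>
        (buyer_turn R h \<longrightarrow>
           buyer_belief E (h @ [m]) = buyer_belief E h \<and>
           bayes_update (seller_belief E h) (\<lambda>i. pmf (buyer_msg (buyer_strat E i) h) m)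
             (seller_belief E (h @ [m]))))"

text \<open>
  The first two conjuncts cover the histories at which messages or the price are still to be
  chosen, with deviations to arbitrary continuation strategies; the third one covers the
  buyer's final decision after each finite price.
\<close>

definition sequentially_rational ::
  "nat \<Rightarrow> nat \<Rightarrow> ('b \<Rightarrow> real) \<Rightarrow> ('s \<Rightarrow> real) \<Rightarrow> ('b, 's) assessment \<Rightarrow> bool" where
  "sequentially_rational M R v c E \<longleftrightarrow>
     (\<forall>h\<in>histories M R. \<forall>i b. is_buyer_strategy M R b \<longrightarrow>
        buyer_value R (v i) (buyer_belief E h) b (seller_strat E) h
        \<le> buyer_value R (v i) (buyer_belief E h) (buyer_strat E i) (seller_strat E) h) \<and>
     (\<forall>h\<in>histories M R. \<forall>k s. is_seller_strategy M R s \<longrightarrow>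
        seller_value R (c k) (seller_belief E h) (buyer_strat E) s h
        \<le> seller_value R (c k) (seller_belief E h) (buyer_strat E) (seller_strat E k) h) \<and>
     (\<forall>h\<in>histories M R. length h = R \<longrightarrow> (\<forall>i p. p < \<infinity> \<longrightarrow>
        (\<forall>a\<in>{0..1}. a * (v i - enn2real p)
           \<le> accept (buyer_strat E i) h p * (v i - enn2real p))))"

definition equilibrium ::
  "nat \<Rightarrow> nat \<Rightarrow> ('b::finite \<Rightarrow> real) \<Rightarrow> ('s::finite \<Rightarrow> real) \<Rightarrow> 'b pmf \<Rightarrow> 's pmf
     \<Rightarrow> ('b, 's) assessment \<Rightarrow> bool" where
  "equilibrium M R v c \<mu> \<nu> E \<longleftrightarrow>
     (\<forall>i. is_buyer_strategy M R (buyer_strat E i)) \<and>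
     (\<forall>k. is_seller_strategy M R (seller_strat E k)) \<and>
     bayes_consistent M R \<mu> \<nu> E \<and>
     sequentially_rational M R v c E"

definition interim_payoff_equivalent ::
  "nat \<Rightarrow> ('b \<Rightarrow> real) \<Rightarrow> ('s \<Rightarrow> real) \<Rightarrow> 'b pmf \<Rightarrow> 's pmf
     \<Rightarrow> ('b, 's) assessment \<Rightarrow> ('b, 's) assessment \<Rightarrow> bool" where
  "interim_payoff_equivalent R v c \<mu> \<nu> E E' \<longleftrightarrow>
     (\<forall>i. buyer_value R (v i) \<nu> (buyer_strat E i) (seller_strat E) []
        = buyer_value R (v i) \<nu> (buyer_strat E' i) (seller_strat E') []) \<and>
     (\<forall>k. seller_value R (c k) \<mu> (buyer_strat E) (seller_strat E k) []
        = seller_value R (c k) \<mu> (buyer_strat E') (seller_strat E' k) [])"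

definition uninformative :: "nat \<Rightarrow> ('b, 's) assessment \<Rightarrow> nat list \<Rightarrow> nat \<Rightarrow> bool" where
  "uninformative R E h m \<longleftrightarrow>
     (seller_turn R h \<longrightarrow> buyer_belief E (h @ [m]) = buyer_belief E h) \<and>
     (buyer_turn R h \<longrightarrow> seller_belief E (h @ [m]) = seller_belief E h)"

definition all_messages_uninformative :: "nat \<Rightarrow> nat \<Rightarrow> ('b, 's) assessment \<Rightarrow> bool" where
  "all_messages_uninformative M R E \<longleftrightarrow>
     (\<forall>h\<in>histories M R. length h < R \<longrightarrow> (\<forall>m\<in>{1..M}. uninformative R E h m))"

end

theory Submission
  imports Defs
begin

text \<open>
  After every history \<open>h\<close> of an equilibrium the seller earns exactly the monopoly profit against
  her belief, and the buyer earns what he would get if the seller types posted suitable optimal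
  monopoly prices without any further talk.  This is proved backwards.  At the end of the talk a
  seller type without a profitable sale gives no surplus to buyers in the support of her belief,
  so her prices can be dropped.  A message of the seller only reveals which of her optimal prices
  she uses, so the prices are averaged.

  A message \<open>m\<close> of the buyer offers the value \<open>x\<close> the payoff \<open>U m x\<close>, a sum of hinges
  \<open>max 0 (x - p)\<close> over the prices \<open>p\<close> posted after \<open>m\<close>.  Each such price is the value of a
  type that sends \<open>m\<close>, so \<open>U m\<close> attains the upper envelope at all its kinks and at the
  highest value that sends \<open>m\<close>.  By convexity \<open>U m\<close> dominates every other \<open>U m'\<close> below that
  value.  Hence all messages lead to the same price distribution below their highest values.
  As optimal prices increase with the cost, this distribution determines the prices of the
  individual seller types, and the prices posted after a message sent by the highest type are
  optimal after every message.  So they are optimal without the message.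
\<close>

subsection \<open>Monopoly prices\<close>

definition demand :: "('b::finite \<Rightarrow> real) \<Rightarrow> 'b pmf \<Rightarrow> real \<Rightarrow> real" where
  "demand v q p = (\<Sum>i | p \<le> v i. pmf q i)"

definition profit :: "('b::finite \<Rightarrow> real) \<Rightarrow> 'b pmf \<Rightarrow> real \<Rightarrow> real \<Rightarrow> real" where
  "profit v q c p = (p - c) * demand v q p"

text \<open>The maximum runs over values only, since a price can be raised to the next value without
  losing a buyer; the inserted 0 is the refusal to sell.\<close>

definition monopoly_profit :: "('b::finite \<Rightarrow> real) \<Rightarrow> 'b pmf \<Rightarrow> real \<Rightarrow> real" where
  "monopoly_profit v q c = Max (insert 0 (profit v q c ` range v))"

text \<open>Being a supported value above cost, every monopoly price is strictly profitable and
  equals the value of a buyer type that the seller deems possible. Such types later control the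
  buyers' payoffs at the kinks.\<close>

definition monopoly_price :: "('b::finite \<Rightarrow> real) \<Rightarrow> 'b pmf \<Rightarrow> real \<Rightarrow> real \<Rightarrow> bool" where
  "monopoly_price v q c p \<longleftrightarrow>
     c < p \<and> p \<in> v ` set_pmf q \<and> profit v q c p = monopoly_profit v q c"

text \<open>
  \<open>g p\<close> is the probability of posting \<open>p\<close>; the zero function stands for refusing to sell.
\<close>

definition posts_optimally ::
  "('b::finite \<Rightarrow> real) \<Rightarrow> 'b pmf \<Rightarrow> real \<Rightarrow> (real \<Rightarrow> real) \<Rightarrow> bool" where
  "posts_optimally v q c g \<longleftrightarrow>
     (if \<exists>i\<in>set_pmf q. c < v i
      then (\<forall>p. 0 \<le> g p \<and> (g p \<noteq> 0 \<longrightarrow> monopoly_price v q c p)) \<and> sum g (range v) = 1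
      else \<forall>p. g p = 0)"

lemma demand_nonneg: "0 \<le> demand v q p"
  by (simp add: demand_def sum_nonneg)

lemma demand_antimono: "x \<le> y \<Longrightarrow> demand v q y \<le> demand v q x"
  unfolding demand_def by (rule sum_mono2) auto

lemma demand_pos_iff: "0 < demand v q p \<longleftrightarrow> (\<exists>i\<in>set_pmf q. p \<le> v i)"
proof -
  have "0 < demand v q p \<longleftrightarrow> demand v q p \<noteq> 0"
    using demand_nonneg[of v q p] by linarith
  also have "\<dots> \<longleftrightarrow> (\<exists>i\<in>set_pmf q. p \<le> v i)"
    unfolding demand_def by (subst sum_nonneg_eq_0_iff) (auto simp: set_pmf_iff)
  finally show ?thesis .
qed

text \<open>A supported type with value exactly \<open>x\<close> buys at \<open>x\<close> but not at
  \<open>y\<close>.\<close>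

lemma demand_strict_antimono:
  assumes "x < y" "x \<in> v ` set_pmf q"
  shows "demand v q y < demand v q x"
proof -
  obtain i where i: "i \<in> set_pmf q" "x = v i" using assms(2) by auto
  have "0 < sum (pmf q) {i}" using i by (simp add: pmf_positive_iff)
  also have "\<dots> \<le> (\<Sum>i\<in>{i. x \<le> v i} - {i. y \<le> v i}. pmf q i)"
    using assms i by (intro sum_mono2) auto
  also have "\<dots> = demand v q x - demand v q y"
    unfolding demand_def using assms by (intro sum_diff) auto
  finally show ?thesis by simp
qed

lemma monopoly_profit_nonneg: "0 \<le> monopoly_profit v q c"
  by (simp add: monopoly_profit_def)

text \<open>Raise \<open>x\<close> to the smallest supported value that is at least
  \<open>x\<close>: no supported type is lost on the way.\<close>

lemma profit_supported_price:
  assumes "c < x" "0 < demand v q x"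
  obtains y where "y \<in> v ` set_pmf q" "x \<le> y" "demand v q y = demand v q x"
proof -
  let ?S = "{i\<in>set_pmf q. x \<le> v i}"
  have ne: "?S \<noteq> {}" using assms(2) by (auto simp: demand_pos_iff)
  define y where "y = Min (v ` ?S)"
  have y: "y \<in> v ` ?S" unfolding y_def using ne by (intro Min_in) auto
  have le: "y \<le> v i" if "i \<in> ?S" for i unfolding y_def using that by (intro Min_le) auto
  have "demand v q x = demand v q y"
    unfolding demand_def
    by (rule sum.mono_neutral_right) (use y le in \<open>auto simp: set_pmf_iff\<close>)
  moreover have "y \<in> v ` set_pmf q" "x \<le> y" using y by auto
  ultimately show thesis using that by metis
qed

lemma profit_le_monopoly_profit: "profit v q c x \<le> monopoly_profit v q c"
proof (cases "c < x \<and> 0 < demand v q x")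
  case True
  then have "c < x" "0 < demand v q x" by auto
  then obtain y where y: "y \<in> v ` set_pmf q" "x \<le> y" "demand v q y = demand v q x"
    by (rule profit_supported_price)
  have "profit v q c x \<le> profit v q c y"
    unfolding profit_def y(3) using y(2) demand_nonneg by (intro mult_right_mono) auto
  also have "\<dots> \<le> monopoly_profit v q c"
    unfolding monopoly_profit_def using y(1) by (intro Max_ge) auto
  finally show ?thesis .
next
  case False
  then have "profit v q c x \<le> 0"
    using demand_nonneg[of v q x] by (auto simp: profit_def mult_le_0_iff)
  then show ?thesis using monopoly_profit_nonneg order_trans by blast
qed

lemma profit_posD:
  assumes "0 < profit v q c p"
  shows "c < p" "0 < demand v q p"
  using assms demand_nonneg[of v q p] by (auto simp: profit_def zero_less_mult_iff)

lemma monopoly_profit_pos_iff: "0 < monopoly_profit v q c \<longleftrightarrow> (\<exists>i\<in>set_pmf q. c < v i)"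
proof
  assume "0 < monopoly_profit v q c"
  moreover have "monopoly_profit v q c \<in> insert 0 (profit v q c ` range v)"
    unfolding monopoly_profit_def by (intro Max_in) auto
  ultimately obtain j where "0 < profit v q c (v j)" by auto
  note j = profit_posD[OF this]
  from j(2) obtain i where "i \<in> set_pmf q" "v j \<le> v i" unfolding demand_pos_iff by blast
  with j(1) show "\<exists>i\<in>set_pmf q. c < v i" by (intro bexI[of _ i]) auto
next
  assume "\<exists>i\<in>set_pmf q. c < v i"
  then obtain i where i: "i \<in> set_pmf q" "c < v i" by auto
  then have "0 < demand v q (v i)" by (auto simp: demand_pos_iff)
  with i have "0 < profit v q c (v i)" by (simp add: profit_def)
  then show "0 < monopoly_profit v q c"
    using profit_le_monopoly_profit less_le_trans by blast
qed

text \<open>An unsupported price could be raised to the next supported value at the same positive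
  demand, which would beat the maximum.\<close>

lemma monopoly_priceI:
  assumes "profit v q c p = monopoly_profit v q c" "0 < monopoly_profit v q c"
  shows "monopoly_price v q c p"
proof -
  have "0 < profit v q c p" using assms by simp
  note pos = profit_posD[OF this]
  obtain y where y: "y \<in> v ` set_pmf q" "p \<le> y" "demand v q y = demand v q p"
    using pos by (rule profit_supported_price)
  have "(y - c) * demand v q p \<le> (p - c) * demand v q p"
    using profit_le_monopoly_profit[of v q c y] assms(1) by (simp add: profit_def y(3))
  with pos have "y \<le> p" by simp
  with y pos assms(1) show ?thesis by (auto simp: monopoly_price_def)
qed

text \<open>\<open>c \<le> p\<close> makes the profit nonnegative, which takes care of the inserted
  0.\<close>

lemma monopoly_profit_eqI:
  assumes "\<And>x. profit v q c x \<le> profit v q c p" "c \<le> p"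
  shows "profit v q c p = monopoly_profit v q c"
proof (rule antisym)
  show "monopoly_profit v q c \<le> profit v q c p"
    unfolding monopoly_profit_def using assms demand_nonneg[of v q p]
    by (subst Max_le_iff) (auto simp: profit_def)
qed (rule profit_le_monopoly_profit)

lemma monopoly_price_ge:
  "monopoly_price v q c p \<Longrightarrow> profit v q c x \<le> profit v q c p"
  using profit_le_monopoly_profit[of v q c x] by (simp add: monopoly_price_def)

lemma profit_shift: "profit v q c p = profit v q c' p + (c' - c) * demand v q p"
  by (simp add: profit_def algebra_simps)

text \<open>Revealed preference: the two optimality conditions add up to
  \<open>demand v q p' \<le> demand v q p\<close>, whereas demand drops strictly above the supported
  value \<open>p'\<close>.\<close>

lemma monopoly_price_mono:
  assumes "monopoly_price v q c p" "monopoly_price v q c' p'" "c < c'"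
  shows "p \<le> p'"
proof (rule ccontr)
  assume "\<not> p \<le> p'"
  then have "demand v q p < demand v q p'"
    using assms(2) by (intro demand_strict_antimono) (auto simp: monopoly_price_def)
  then have "(c' - c) * demand v q p < (c' - c) * demand v q p'"
    using assms(3) by simp
  with monopoly_price_ge[OF assms(1), of p'] monopoly_price_ge[OF assms(2), of p]
  show False by (simp add: profit_shift[of v q c _ c'])
qed

text \<open>The advantage of \<open>p\<close> over a rival price is affine in the cost. Rivals that
  sell more are compared at \<open>c1\<close>, the others at \<open>c2\<close>.\<close>

lemma monopoly_price_between:
  assumes "monopoly_price v q c1 p" "monopoly_price v q c2 p" "c1 \<le> c" "c \<le> c2"
  shows "profit v q c p = monopoly_profit v q c"
proof (rule monopoly_profit_eqI)
  fix x
  show "profit v q c x \<le> profit v q c p"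
  proof (cases "demand v q x \<le> demand v q p")
    case True
    then have "(c2 - c) * demand v q x \<le> (c2 - c) * demand v q p"
      using assms(4) by (intro mult_left_mono) auto
    with monopoly_price_ge[OF assms(2), of x] show ?thesis
      by (simp add: profit_shift[of v q c _ c2])
  next
    case False
    then have "(c - c1) * demand v q p \<le> (c - c1) * demand v q x"
      using assms(3) by (intro mult_left_mono) auto
    with monopoly_price_ge[OF assms(1), of x] show ?thesis
      by (simp add: profit_shift[of v q c _ c1] algebra_simps)
  qed
qed (use assms in \<open>auto simp: monopoly_price_def\<close>)

text \<open>A lower price sells at least as much, so a higher cost only weakens it relative to
  \<open>p\<close>; a price above \<open>p\<close> sells nothing.\<close>

lemma monopoly_price_top:
  assumes "monopoly_price v q c1 p" "\<And>i. i \<in> set_pmf q \<Longrightarrow> v i \<le> p" "c1 \<le> c" "c \<le> p"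
  shows "profit v q c p = monopoly_profit v q c"
proof (rule monopoly_profit_eqI)
  fix x
  show "profit v q c x \<le> profit v q c p"
  proof (cases "x \<le> p")
    case True
    then have "(c - c1) * demand v q p \<le> (c - c1) * demand v q x"
      using assms(3) demand_antimono by (intro mult_left_mono) auto
    with monopoly_price_ge[OF assms(1), of x] show ?thesis
      by (simp add: profit_shift[of v q c _ c1] algebra_simps)
  next
    case False
    then have "\<not> 0 < demand v q x" using assms(2) by (force simp: demand_pos_iff)
    then have "demand v q x = 0" using demand_nonneg[of v q x] by simp
    then show ?thesis using assms(4) demand_nonneg[of v q p] by (simp add: profit_def)
  qed
qed (fact assms(4))

lemma posts_optimallyD:
  assumes "posts_optimally v q c g"
  shows "0 \<le> g p" "g p \<noteq> 0 \<Longrightarrow> monopoly_price v q c p" "sum g (range v) \<le> 1"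
    "i \<in> set_pmf q \<Longrightarrow> c < v i \<Longrightarrow> sum g (range v) = 1"
  using assms by (auto simp: posts_optimally_def split: if_splits)

subsection \<open>Sums of hinge functions\<close>

text \<open>The payoff of a buyer of value \<open>x\<close> who meets the price \<open>p\<close>
  with probability \<open>w p\<close>; its kinks in \<open>x\<close> are the prices of nonzero
  weight.\<close>

definition hinge_sum :: "real set \<Rightarrow> (real \<Rightarrow> real) \<Rightarrow> real \<Rightarrow> real" where
  "hinge_sum V w x = (\<Sum>p\<in>V. w p * max 0 (x - p))"

text \<open>\<open>mass_below\<close> and \<open>mass_upto\<close> are the left and the right
  derivative of \<open>hinge_sum\<close> at \<open>x\<close>.\<close>

definition mass_below :: "real set \<Rightarrow> (real \<Rightarrow> real) \<Rightarrow> real \<Rightarrow> real" where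
  "mass_below V w x = (\<Sum>p\<in>{p\<in>V. p < x}. w p)"

definition mass_upto :: "real set \<Rightarrow> (real \<Rightarrow> real) \<Rightarrow> real \<Rightarrow> real" where
  "mass_upto V w x = (\<Sum>p\<in>{p\<in>V. p \<le> x}. w p)"

text \<open>The chord inequality is multiplied by \<open>b - a\<close>, so that \<open>a = b\<close>
  is covered as well.\<close>

lemma hinge_convex:
  fixes a b x p :: real
  assumes "a \<le> x" "x \<le> b"
  shows "(b - a) * max 0 (x - p) \<le> (b - x) * max 0 (a - p) + (x - a) * max 0 (b - p)"
proof (cases "p \<le> x")
  case True
  have "(b - a) * (x - p) = (b - x) * (a - p) + (x - a) * (b - p)" by (simp add: algebra_simps)
  also have "\<dots> \<le> (b - x) * max 0 (a - p) + (x - a) * max 0 (b - p)"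
    using assms by (intro add_mono mult_left_mono) auto
  finally show ?thesis using True by simp
next
  case False
  then show ?thesis using assms by simp
qed

lemma hinge_sum_convex:
  assumes "\<And>p. p \<in> V \<Longrightarrow> 0 \<le> w p" "a \<le> x" "x \<le> b"
  shows "(b - a) * hinge_sum V w x \<le> (b - x) * hinge_sum V w a + (x - a) * hinge_sum V w b"
proof -
  have "(b - a) * hinge_sum V w x = (\<Sum>p\<in>V. w p * ((b - a) * max 0 (x - p)))"
    by (simp add: hinge_sum_def sum_distrib_left algebra_simps)
  also have "\<dots> \<le> (\<Sum>p\<in>V. w p * ((b - x) * max 0 (a - p) + (x - a) * max 0 (b - p)))"
    using assms hinge_convex by (intro sum_mono mult_left_mono) auto
  also have "\<dots> = (b - x) * hinge_sum V w a + (x - a) * hinge_sum V w b"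
    by (simp add: hinge_sum_def sum_distrib_left sum.distrib[symmetric] distrib_left mult.left_commute)
  finally show ?thesis .
qed

lemma hinge_sum_affine:
  assumes "\<And>p. p \<in> V \<Longrightarrow> w p \<noteq> 0 \<Longrightarrow> p \<le> a \<or> b \<le> p" "a \<le> x" "x \<le> b"
  shows "(b - a) * hinge_sum V w x = (b - x) * hinge_sum V w a + (x - a) * hinge_sum V w b"
proof -
  have "(b - a) * hinge_sum V w x = (\<Sum>p\<in>V. w p * ((b - a) * max 0 (x - p)))"
    by (simp add: hinge_sum_def sum_distrib_left algebra_simps)
  also have "\<dots> = (\<Sum>p\<in>V. w p * ((b - x) * max 0 (a - p) + (x - a) * max 0 (b - p)))"
  proof (rule sum.cong)
    fix p assume "p \<in> V"
    show "w p * ((b - a) * max 0 (x - p)) =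
        w p * ((b - x) * max 0 (a - p) + (x - a) * max 0 (b - p))"
    proof (cases "w p = 0")
      case False
      with assms(1) \<open>p \<in> V\<close> have "p \<le> a \<or> b \<le> p" by auto
      then have "(b - a) * max 0 (x - p) = (b - x) * max 0 (a - p) + (x - a) * max 0 (b - p)"
        using assms(2,3) by (auto simp: algebra_simps)
      then show ?thesis by simp
    qed simp
  qed simp
  also have "\<dots> = (b - x) * hinge_sum V w a + (x - a) * hinge_sum V w b"
    by (simp add: hinge_sum_def sum_distrib_left sum.distrib[symmetric] distrib_left mult.left_commute)
  finally show ?thesis .
qed

text \<open>Between neighbouring kinks of \<open>w\<close> its sum is affine while that of
  \<open>w'\<close> is convex, so a comparison at the two ends suffices.\<close>

lemma hinge_sum_dominates:
  assumes V: "finite V" and w': "\<And>p. p \<in> V \<Longrightarrow> 0 \<le> w' p"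
    and kinks: "\<And>p. p \<in> V \<Longrightarrow> w p \<noteq> 0 \<Longrightarrow> hinge_sum V w' p \<le> hinge_sum V w p"
    and t: "hinge_sum V w' t \<le> hinge_sum V w t" and "x \<le> t"
  shows "hinge_sum V w' x \<le> hinge_sum V w x"
proof -
  \<comment> \<open>Both sums vanish at \<open>z\<close>, which replaces the left kink if
    \<open>w\<close> has none up to \<open>x\<close>.\<close>
  define z where "z = Min (insert x V)"
  have z: "z \<le> x" "\<And>p. p \<in> V \<Longrightarrow> z \<le> p" unfolding z_def using V by auto
  have z0: "hinge_sum V u z = 0" for u
    unfolding hinge_sum_def using z(2) by (intro sum.neutral) simp
  \<comment> \<open>\<open>a\<close> and \<open>b\<close> will be the nearest kinks of
    \<open>w\<close> on either side of \<open>x\<close>, with \<open>z\<close> and \<open>t\<close>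
    as fallbacks.\<close>
  let ?A = "insert z {p\<in>V. w p \<noteq> 0 \<and> p \<le> x}" and ?B = "insert t {p\<in>V. w p \<noteq> 0 \<and> x \<le> p \<and> p \<le> t}"
  define a where "a = Max ?A"
  define b where "b = Min ?B"
  have a: "a \<in> ?A" unfolding a_def using V by (intro Max_in) auto
  have b: "b \<in> ?B" unfolding b_def using V by (intro Min_in) auto
  have amax: "p \<le> a" if "p \<in> ?A" for p unfolding a_def using V that by (intro Max_ge) auto
  have bmin: "b \<le> p" if "p \<in> ?B" for p unfolding b_def using V that by (intro Min_le) auto
  have ax: "a \<le> x" using a z by auto
  have xb: "x \<le> b" using b \<open>x \<le> t\<close> by auto
  have Da: "hinge_sum V w' a \<le> hinge_sum V w a" using a kinks z0 by auto
  have Db: "hinge_sum V w' b \<le> hinge_sum V w b" using b kinks t by auto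
  show ?thesis
  proof (cases "a = b")
    case True
    with ax xb Da show ?thesis by simp
  next
    case False
    have aff: "p \<le> a \<or> b \<le> p" if "p \<in> V" "w p \<noteq> 0" for p
    proof (cases "p \<le> x")
      case True then show ?thesis using amax that by auto
    next
      case False
      show ?thesis
      proof (cases "p \<le> t")
        case True then show ?thesis using bmin[of p] that False by auto
      next
        case False then show ?thesis using bmin[of t] by auto
      qed
    qed
    have "(b - a) * hinge_sum V w' x \<le> (b - x) * hinge_sum V w' a + (x - a) * hinge_sum V w' b"
      using w' ax xb by (rule hinge_sum_convex)
    also have "\<dots> \<le> (b - x) * hinge_sum V w a + (x - a) * hinge_sum V w b"
      using ax xb Da Db by (intro add_mono mult_left_mono) auto
    also have "\<dots> = (b - a) * hinge_sum V w x"
      using aff ax xb by (rule hinge_sum_affine[symmetric])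
    finally show ?thesis using False ax xb by simp
  qed
qed

text \<open>The radius \<open>d\<close> depends on \<open>V\<close> and \<open>x\<close> alone, so
  the slopes of two weight functions can be compared with the same increment.\<close>

lemma hinge_sum_slopes:
  assumes V: "finite V"
  obtains d where "0 < d"
    "\<And>w e. 0 \<le> e \<Longrightarrow> e \<le> d \<Longrightarrow> hinge_sum V w (x + e) = hinge_sum V w x + e * mass_upto V w x"
    "\<And>w e. 0 \<le> e \<Longrightarrow> e \<le> d \<Longrightarrow> hinge_sum V w (x - e) = hinge_sum V w x - e * mass_below V w x"
proof -
  \<comment> \<open>The distance from \<open>x\<close> to the nearest other point of
    \<open>V\<close>; the 1 keeps the set nonempty.\<close>
  define d where "d = Min (insert 1 ((\<lambda>p. \<bar>p - x\<bar>) ` (V - {x})))"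
  have "d \<in> insert 1 ((\<lambda>p. \<bar>p - x\<bar>) ` (V - {x}))"
    unfolding d_def using V by (intro Min_in) auto
  then have "0 < d" by auto
  have d: "d \<le> \<bar>p - x\<bar>" if "p \<in> V" "p \<noteq> x" for p
    unfolding d_def using V that by (intro Min_le) auto
  show thesis
  proof (rule that[OF \<open>0 < d\<close>])
    fix w e assume e: "0 \<le> e" "e \<le> d"
    have "hinge_sum V w x + e * mass_upto V w x =
        (\<Sum>p\<in>V. w p * max 0 (x - p) + e * (if p \<le> x then w p else 0))"
      using V by (simp add: hinge_sum_def mass_upto_def sum.distrib sum.inter_filter sum_distrib_left)
    also have "\<dots> = hinge_sum V w (x + e)"
      unfolding hinge_sum_def
    proof (rule sum.cong)
      fix p assume "p \<in> V"
      then have "p = x \<or> e \<le> \<bar>p - x\<bar>" using d e by fastforce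
      then show "w p * max 0 (x - p) + e * (if p \<le> x then w p else 0) = w p * max 0 (x + e - p)"
        using e(1) by (cases p x rule: linorder_cases) (simp_all add: algebra_simps max_def)
    qed simp
    finally show "hinge_sum V w (x + e) = hinge_sum V w x + e * mass_upto V w x" ..
    have "hinge_sum V w x - e * mass_below V w x =
        (\<Sum>p\<in>V. w p * max 0 (x - p) - e * (if p < x then w p else 0))"
      using V by (simp add: hinge_sum_def mass_below_def sum_subtractf sum.inter_filter sum_distrib_left)
    also have "\<dots> = hinge_sum V w (x - e)"
      unfolding hinge_sum_def
    proof (rule sum.cong)
      fix p assume "p \<in> V"
      then have "p = x \<or> e \<le> \<bar>p - x\<bar>" using d e by fastforce
      then show "w p * max 0 (x - p) - e * (if p < x then w p else 0) = w p * max 0 (x - e - p)"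
        using e(1) by (cases p x rule: linorder_cases) (simp_all add: algebra_simps max_def)
    qed simp
    finally show "hinge_sum V w (x - e) = hinge_sum V w x - e * mass_below V w x" ..
  qed
qed

lemma mass_below_eqI:
  assumes "finite V" "\<And>y. y \<le> x \<Longrightarrow> hinge_sum V w y = hinge_sum V w' y"
  shows "mass_below V w x = mass_below V w' x"
proof -
  obtain d where d: "0 < d"
    "\<And>w e. 0 \<le> e \<Longrightarrow> e \<le> d \<Longrightarrow> hinge_sum V w (x - e) = hinge_sum V w x - e * mass_below V w x"
    using hinge_sum_slopes[OF assms(1)] by metis
  have "d * mass_below V w x = d * mass_below V w' x"
    using d(2)[of d w] d(2)[of d w'] assms(2)[of x] assms(2)[of "x - d"] d(1) by simp
  then show ?thesis using d(1) by simp
qed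

lemma mass_upto_leI:
  assumes "finite V" "x < t" "hinge_sum V w x = hinge_sum V w' x"
    "\<And>y. x \<le> y \<Longrightarrow> y \<le> t \<Longrightarrow> hinge_sum V w y \<le> hinge_sum V w' y"
  shows "mass_upto V w x \<le> mass_upto V w' x"
proof -
  obtain d where d: "0 < d"
    "\<And>w e. 0 \<le> e \<Longrightarrow> e \<le> d \<Longrightarrow> hinge_sum V w (x + e) = hinge_sum V w x + e * mass_upto V w x"
    using hinge_sum_slopes[OF assms(1)] by metis
  \<comment> \<open>Small enough for the slope formula and for \<open>x + e \<le> t\<close>.\<close>
  define e where "e = min d (t - x)"
  have e: "0 < e" "e \<le> d" "x + e \<le> t" using d(1) assms(2) by (auto simp: e_def)
  have "e * mass_upto V w x \<le> e * mass_upto V w' x"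
    using d(2)[of e w] d(2)[of e w'] assms(3) assms(4)[of "x + e"] e by simp
  then show ?thesis using e(1) by simp
qed

subsection \<open>Pooling the buyer's messages\<close>

lemma mass_upto_eq:
  assumes "finite V"
  shows "mass_upto V w x = mass_below V w x + (if x \<in> V then w x else 0)"
proof -
  have "{p\<in>V. p \<le> x} = {p\<in>V. p < x} \<union> (if x \<in> V then {x} else {})"
    by (auto simp: order_le_less)
  then show ?thesis
    using assms unfolding mass_upto_def mass_below_def by (simp add: sum.union_disjoint)
qed

lemma mass_aggregate:
  "mass_below V (\<lambda>p. \<Sum>k\<in>K. a k * g k p) x = (\<Sum>k\<in>K. a k * mass_below V (g k) x)"
  "mass_upto V (\<lambda>p. \<Sum>k\<in>K. a k * g k p) x = (\<Sum>k\<in>K. a k * mass_upto V (g k) x)"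
  by (simp_all add: mass_below_def mass_upto_def sum_distrib_left sum.swap[of _ K])

section \<open>Prices and quantiles of the seller's cost\<close>

lemma posts_optimally_mass_bounds:
  assumes "posts_optimally v q c g"
  shows "0 \<le> mass_below (range v) g x" "0 \<le> mass_upto (range v) g x"
    "mass_below (range v) g x \<le> 1" "mass_upto (range v) g x \<le> 1"
proof -
  note g = posts_optimallyD[OF assms]
  show "0 \<le> mass_below (range v) g x" "0 \<le> mass_upto (range v) g x"
    unfolding mass_below_def mass_upto_def using g(1) by (auto intro!: sum_nonneg)
  have "mass_below (range v) g x \<le> sum g (range v)" "mass_upto (range v) g x \<le> sum g (range v)"
    unfolding mass_below_def mass_upto_def using g(1) by (auto intro!: sum_mono2)
  then show "mass_below (range v) g x \<le> 1" "mass_upto (range v) g x \<le> 1"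
    using g(3) by auto
qed

lemma posts_optimally_mass_upto_eq_1:
  assumes "posts_optimally v q c g" "i \<in> set_pmf q" "c < v i"
    "\<And>y. g y \<noteq> 0 \<Longrightarrow> y \<le> x"
  shows "mass_upto (range v) g x = 1"
proof -
  have "mass_upto (range v) g x = sum g (range v)"
    unfolding mass_upto_def by (rule sum.mono_neutral_left) (use assms(4) in auto)
  then show ?thesis using posts_optimallyD(4)[OF assms(1-3)] by simp
qed

text \<open>
  Sellers with lower costs post lower prices, so a price posted by type \<open>k\<close> sits in the price
  distribution at the quantile occupied by the cost level of \<open>k\<close>.
\<close>

lemma price_quantile:
  fixes \<rho> :: "'s::finite pmf"
  assumes opt: "\<And>l. l \<in> set_pmf \<rho> \<Longrightarrow> posts_optimally v q (c l) (g l)"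
    and k: "k \<in> set_pmf \<rho>" "g k p \<noteq> 0"
  shows "(\<Sum>l\<in>UNIV. pmf \<rho> l * mass_below (range v) (g l) p) <
      (\<Sum>l\<in>UNIV. if c l \<le> c k then pmf \<rho> l else 0)"
    and "(\<Sum>l\<in>UNIV. if c l < c k then pmf \<rho> l else 0) <
      (\<Sum>l\<in>UNIV. pmf \<rho> l * mass_upto (range v) (g l) p)"
proof -
  note gk = posts_optimallyD[OF opt[OF k(1)]]
  have p: "monopoly_price v q (c k) p" using gk k by blast
  then obtain i where i: "i \<in> set_pmf q" "p = v i" "c k < v i"
    by (auto simp: monopoly_price_def)
  have \<rho>k: "0 < pmf \<rho> k" using k by (simp add: pmf_positive_iff)
  have gp: "0 < g k p" using gk(1)[of p] k(2) by simp
  \<comment> \<open>Types with higher costs post at least \<open>p\<close>.\<close>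
  have below0: "mass_below (range v) (g l) p = 0" if l: "l \<in> set_pmf \<rho>" "c k < c l" for l
    unfolding mass_below_def
  proof (rule sum.neutral, safe)
    fix j assume "v j < p"
    then show "g l (v j) = 0"
      using monopoly_price_mono[OF p _ l(2)] posts_optimallyD(2)[OF opt[OF l(1)], of "v j"]
      by force
  qed
  \<comment> \<open>A cheaper type can sell profitably to the buyer with value \<open>p\<close>, so
    it posts with full mass, all of it at most \<open>p\<close>.\<close>
  have upto1: "mass_upto (range v) (g l) p = 1" if l: "l \<in> set_pmf \<rho>" "c l < c k" for l
  proof (rule posts_optimally_mass_upto_eq_1[OF opt[OF l(1)] i(1)])
    show "c l < v i" using l i by simp
    fix y assume "g l y \<noteq> 0"
    then show "y \<le> p"
      using monopoly_price_mono[OF _ p l(2)] posts_optimallyD(2)[OF opt[OF l(1)]] by blast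
  qed
  note bounds = posts_optimally_mass_bounds[OF opt]
  have split: "mass_upto (range v) (g k) p = mass_below (range v) (g k) p + g k p"
    using i by (simp add: mass_upto_eq)
  show "(\<Sum>l\<in>UNIV. pmf \<rho> l * mass_below (range v) (g l) p) <
      (\<Sum>l\<in>UNIV. if c l \<le> c k then pmf \<rho> l else 0)"
  proof (rule sum_strict_mono_ex1)
    show "\<forall>l\<in>UNIV. pmf \<rho> l * mass_below (range v) (g l) p \<le> (if c l \<le> c k then pmf \<rho> l else 0)"
    proof
      fix l
      show "pmf \<rho> l * mass_below (range v) (g l) p \<le> (if c l \<le> c k then pmf \<rho> l else 0)"
        using bounds(3)[of l p] below0[of l]
        by (cases "l \<in> set_pmf \<rho>") (auto intro: mult_left_le simp: set_pmf_iff)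
    qed
    \<comment> \<open>Strictness comes from type \<open>k\<close>, which posts \<open>p\<close>
      itself with positive probability.\<close>
    have "mass_below (range v) (g k) p < 1" using bounds(4)[OF k(1), of p] gp split by simp
    then show "\<exists>l\<in>UNIV. pmf \<rho> l * mass_below (range v) (g l) p < (if c l \<le> c k then pmf \<rho> l else 0)"
      using \<rho>k by (intro bexI[of _ k]) auto
  qed simp
  show "(\<Sum>l\<in>UNIV. if c l < c k then pmf \<rho> l else 0) <
      (\<Sum>l\<in>UNIV. pmf \<rho> l * mass_upto (range v) (g l) p)"
  proof (rule sum_strict_mono_ex1)
    show "\<forall>l\<in>UNIV. (if c l < c k then pmf \<rho> l else 0) \<le> pmf \<rho> l * mass_upto (range v) (g l) p"
    proof
      fix l
      show "(if c l < c k then pmf \<rho> l else 0) \<le> pmf \<rho> l * mass_upto (range v) (g l) p"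
        using bounds(2)[of l p] upto1[of l]
        by (cases "l \<in> set_pmf \<rho>") (auto simp: set_pmf_iff)
    qed
    have "0 < mass_upto (range v) (g k) p" using bounds(1)[OF k(1), of p] gp split by simp
    then show "\<exists>l\<in>UNIV. (if c l < c k then pmf \<rho> l else 0) < pmf \<rho> l * mass_upto (range v) (g l) p"
      using \<rho>k by (intro bexI[of _ k]) auto
  qed simp
qed

text \<open>If the types with cost up to \<open>c k\<close> posted only below \<open>p\<close>, each
  would place mass 1 there, because \<open>v i\<close> offers all of them a profitable sale.\<close>

lemma price_at_quantile_above:
  fixes \<rho> :: "'s::finite pmf"
  assumes opt: "\<And>l. l \<in> set_pmf \<rho> \<Longrightarrow> posts_optimally v q (c l) (g l)"
    and i: "i \<in> set_pmf q" "c k < v i"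
    and less: "(\<Sum>l\<in>UNIV. pmf \<rho> l * mass_below (range v) (g l) p) <
      (\<Sum>l\<in>UNIV. if c l \<le> c k then pmf \<rho> l else 0)"
  obtains l x where "c l \<le> c k" "p \<le> x" "monopoly_price v q (c l) x"
proof -
  have "\<exists>l. pmf \<rho> l * mass_below (range v) (g l) p < (if c l \<le> c k then pmf \<rho> l else 0)"
    using less by (meson not_le sum_mono)
  then obtain l where l: "pmf \<rho> l * mass_below (range v) (g l) p < (if c l \<le> c k then pmf \<rho> l else 0)"
    by blast
  then have supp: "l \<in> set_pmf \<rho>" by (auto simp: set_pmf_iff split: if_splits)
  then have pos: "0 < pmf \<rho> l" by (simp add: pmf_positive_iff)
  have "0 \<le> pmf \<rho> l * mass_below (range v) (g l) p"
    using posts_optimally_mass_bounds(1)[OF opt[OF supp]] by simp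
  with l have cl: "c l \<le> c k" by (auto split: if_splits)
  with l pos have lt1: "mass_below (range v) (g l) p < 1" by auto
  have "sum (g l) (range v) = 1" using posts_optimallyD(4)[OF opt[OF supp] i(1)] i(2) cl by simp
  moreover have "sum (g l) (range v) = mass_below (range v) (g l) p"
    if "\<And>x. p \<le> x \<Longrightarrow> g l x = 0"
    unfolding mass_below_def by (rule sum.mono_neutral_right) (use that not_le in auto)
  ultimately obtain x where "p \<le> x" "g l x \<noteq> 0" using lt1 by fastforce
  with cl show thesis using that posts_optimallyD(2)[OF opt[OF supp]] by blast
qed

text \<open>A summand on the right of \<open>less\<close> is at most \<open>pmf \<rho> l\<close>, so
  it can be the larger one only for a type with cost at least \<open>c k\<close>, and that type
  posts some price up to \<open>p\<close>.\<close>

lemma price_at_quantile_upto: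
  fixes \<rho> :: "'s::finite pmf"
  assumes opt: "\<And>l. l \<in> set_pmf \<rho> \<Longrightarrow> posts_optimally v q (c l) (g l)"
    and less: "(\<Sum>l\<in>UNIV. if c l < c k then pmf \<rho> l else 0) <
      (\<Sum>l\<in>UNIV. pmf \<rho> l * mass_upto (range v) (g l) p)"
  obtains l x where "c k \<le> c l" "x \<le> p" "monopoly_price v q (c l) x"
proof -
  have "\<exists>l. (if c l < c k then pmf \<rho> l else 0) < pmf \<rho> l * mass_upto (range v) (g l) p"
    using less by (meson not_le sum_mono)
  then obtain l where l: "(if c l < c k then pmf \<rho> l else 0) < pmf \<rho> l * mass_upto (range v) (g l) p"
    by blast
  then have supp: "l \<in> set_pmf \<rho>" by (auto simp: set_pmf_iff split: if_splits)
  have "pmf \<rho> l * mass_upto (range v) (g l) p \<le> pmf \<rho> l"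
    using posts_optimally_mass_bounds(4)[OF opt[OF supp]] by (simp add: mult_left_le)
  with l have cl: "c k \<le> c l" by (auto split: if_splits)
  with l have "mass_upto (range v) (g l) p \<noteq> 0" by auto
  then obtain x where "x \<le> p" "g l x \<noteq> 0"
    unfolding mass_upto_def by (metis (mono_tags, lifting) mem_Collect_eq sum.neutral)
  with cl show thesis using that posts_optimallyD(2)[OF opt[OF supp]] by blast
qed

text \<open>Prices follow the cost order against either belief, and the aggregate price
  distributions agree below \<open>t\<close>. Hence a price that type \<open>k\<close> posts against
  \<open>q'\<close> sits at the same quantile against \<open>q\<close>, where types with costs
  around \<open>c k\<close> post.\<close>

lemma monopoly_price_transfer:
  fixes \<rho> :: "'s::finite pmf"
  assumes opt: "\<And>l. l \<in> set_pmf \<rho> \<Longrightarrow> posts_optimally v q (c l) (g l)"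
    and opt': "\<And>l. l \<in> set_pmf \<rho> \<Longrightarrow> posts_optimally v q' (c l) (g' l)"
    and t: "t \<in> v ` set_pmf q" "\<And>i. i \<in> set_pmf q \<Longrightarrow> v i \<le> t"
    and below: "\<And>x. x \<le> t \<Longrightarrow> (\<Sum>l\<in>UNIV. pmf \<rho> l * mass_below (range v) (g l) x) =
        (\<Sum>l\<in>UNIV. pmf \<rho> l * mass_below (range v) (g' l) x)"
    and upto: "\<And>x. x < t \<Longrightarrow> (\<Sum>l\<in>UNIV. pmf \<rho> l * mass_upto (range v) (g l) x) =
        (\<Sum>l\<in>UNIV. pmf \<rho> l * mass_upto (range v) (g' l) x)"
    and top: "\<And>i. i \<in> set_pmf q' \<Longrightarrow> t < v i \<Longrightarrow>
        (\<Sum>l\<in>UNIV. pmf \<rho> l * mass_upto (range v) (g l) t) \<le>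
        (\<Sum>l\<in>UNIV. pmf \<rho> l * mass_upto (range v) (g' l) t)"
    and k: "k \<in> set_pmf \<rho>" "g' k p \<noteq> 0"
  shows "profit v q (c k) p = monopoly_profit v q (c k)"
proof -
  note quantile = price_quantile[where c = c and g = g', OF opt' k]
  have p: "monopoly_price v q' (c k) p" using posts_optimallyD(2)[OF opt'[OF k(1)]] k(2) .
  then obtain j where j: "j \<in> set_pmf q'" "p = v j" "c k < p" by (auto simp: monopoly_price_def)
  obtain i where i: "i \<in> set_pmf q" "t = v i" using t(1) by auto
  consider "p < t" | "p = t" | "t < p" by linarith
  then show ?thesis
  proof cases
    case 1
    have ck: "c k < v i" using 1 i j by simp
    obtain l x where l: "c l \<le> c k" "p \<le> x" "monopoly_price v q (c l) x"
      by (rule price_at_quantile_above[where \<rho> = \<rho> and c = c and g = g and p = p, OF opt i(1) ck]) (use 1 quantile(1) below[of p] in auto)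
    obtain l' x' where l': "c k \<le> c l'" "x' \<le> p" "monopoly_price v q (c l') x'"
      by (rule price_at_quantile_upto[where \<rho> = \<rho> and c = c and g = g and k = k and p = p, OF opt]) (use 1 quantile(2) upto[of p] in auto)
    \<comment> \<open>The masses up to \<open>p\<close> and strictly below \<open>p\<close> agree,
      so \<open>p\<close> itself has the same positive mass under \<open>g\<close>;
      \<open>l0\<close> is a type that posts it.\<close>
    have "(\<Sum>l\<in>UNIV. pmf \<rho> l * g l p) = (\<Sum>l\<in>UNIV. pmf \<rho> l * g' l p)"
      using below[of p] upto[of p] 1 j(2)
      by (simp add: mass_upto_eq distrib_left sum.distrib)
    also have "\<dots> > 0"
    proof (rule sum_pos2[of _ k])
      show "0 < pmf \<rho> k * g' k p"
        using k posts_optimallyD(1)[OF opt'[OF k(1)], of p] by (simp add: pmf_positive_iff)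
      show "0 \<le> pmf \<rho> l * g' l p" for l
        using posts_optimallyD(1)[OF opt'[of l], of p] by (cases "l \<in> set_pmf \<rho>") (auto simp: set_pmf_iff)
    qed auto
    finally obtain l0 where l0: "pmf \<rho> l0 * g l0 p \<noteq> 0"
      by (metis (no_types, lifting) less_irrefl sum.neutral)
    then have p0: "monopoly_price v q (c l0) p"
      using posts_optimallyD(2)[OF opt[of l0], of p] by (auto simp: set_pmf_iff)
    consider "c l0 = c k" | "c l0 < c k" | "c k < c l0" by linarith
    then show ?thesis
    proof cases
      case 1
      then show ?thesis using p0 by (simp add: monopoly_price_def)
    next
      case 2
      \<comment> \<open>\<open>l'\<close> has a higher cost than \<open>l0\<close> but posts at most
        \<open>p\<close>. Monotonicity forces equality, so \<open>p\<close> is optimal at costs on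
        both sides of \<open>c k\<close>.\<close>
      then have "x' = p" using monopoly_price_mono[OF p0 l'(3)] l' by simp
      then show ?thesis using monopoly_price_between[OF p0] l' 2 by simp
    next
      case 3
      then have "x = p" using monopoly_price_mono[OF l(3) p0] l by simp
      then show ?thesis using monopoly_price_between[OF _ p0] l 3 by simp
    qed
  next
    case 2
    then have ck: "c k < v i" using i j by simp
    obtain l x where l: "c l \<le> c k" "p \<le> x" "monopoly_price v q (c l) x"
      by (rule price_at_quantile_above[where \<rho> = \<rho> and c = c and g = g and p = p, OF opt i(1) ck]) (use 2 quantile(1) below[of p] in auto)
    \<comment> \<open>No supported value exceeds \<open>t = p\<close>, so a monopoly price of at
      least \<open>p\<close> equals \<open>p\<close>.\<close>
    then have "x = p" using t(2) 2 by (force simp: monopoly_price_def)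
    with l 2 t(2) j(3) show ?thesis by (intro monopoly_price_top[of v q "c l"]) auto
  next
    case 3
    have "demand v q p = 0"
      using demand_nonneg[of v q p] demand_pos_iff[of v q p] t(2) 3 by force
    then have profit0: "profit v q (c k) p = 0" by (simp add: profit_def)
    \<comment> \<open>Otherwise the types with cost up to \<open>c k\<close> all post at most
      \<open>t\<close> under \<open>g\<close>, whereas under \<open>g'\<close> the prices below
      \<open>p\<close> do not exhaust their total mass; this contradicts \<open>top\<close>. Once
      \<open>t \<le> c k\<close>, no sale is profitable and both profits are 0.\<close>
    have "\<not> c k < t"
    proof
      assume less: "c k < t"
      have "(\<Sum>l\<in>UNIV. pmf \<rho> l * mass_upto (range v) (g' l) t) \<le>
          (\<Sum>l\<in>UNIV. pmf \<rho> l * mass_below (range v) (g' l) p)"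
      proof (rule sum_mono)
        fix l
        have "mass_upto (range v) (g' l) t \<le> mass_below (range v) (g' l) p" if "l \<in> set_pmf \<rho>"
          unfolding mass_upto_def mass_below_def
          using 3 posts_optimallyD(1)[OF opt'[OF that]] by (intro sum_mono2) auto
        then show "pmf \<rho> l * mass_upto (range v) (g' l) t \<le> pmf \<rho> l * mass_below (range v) (g' l) p"
          by (cases "l \<in> set_pmf \<rho>") (auto simp: set_pmf_iff intro: mult_left_mono)
      qed
      also note quantile(1)
      also have "(\<Sum>l\<in>UNIV. if c l \<le> c k then pmf \<rho> l else 0) \<le>
          (\<Sum>l\<in>UNIV. pmf \<rho> l * mass_upto (range v) (g l) t)"
      proof (rule sum_mono)
        fix l
        show "(if c l \<le> c k then pmf \<rho> l else 0) \<le> pmf \<rho> l * mass_upto (range v) (g l) t"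
        proof (cases "l \<in> set_pmf \<rho>")
          case True
          have "mass_upto (range v) (g l) t = 1" if "c l \<le> c k"
          proof (rule posts_optimally_mass_upto_eq_1[OF opt[OF True] i(1)])
            show "c l < v i" using that less i by simp
            fix y assume "g l y \<noteq> 0"
            then have "monopoly_price v q (c l) y" by (rule posts_optimallyD(2)[OF opt[OF True]])
            then show "y \<le> t" using t(2) by (auto simp: monopoly_price_def)
          qed
          then show ?thesis using posts_optimally_mass_bounds(2)[OF opt[OF True]] by simp
        qed (simp add: set_pmf_iff)
      qed
      also have "\<dots> \<le> (\<Sum>l\<in>UNIV. pmf \<rho> l * mass_upto (range v) (g' l) t)"
        using top[of j] j 3 by simp
      finally show False by simp
    qed
    then have "\<not> 0 < monopoly_profit v q (c k)"
      using t(2) by (force simp: monopoly_profit_pos_iff)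
    then show ?thesis using profit0 monopoly_profit_nonneg[of v q "c k"] by simp
  qed
qed

section \<open>Merging the messages of one round\<close>

definition surplus ::
  "('b::finite \<Rightarrow> real) \<Rightarrow> 's::finite pmf \<Rightarrow> ('s \<Rightarrow> real \<Rightarrow> real) \<Rightarrow> real \<Rightarrow> real" where
  "surplus v \<rho> g = hinge_sum (range v) (\<lambda>p. \<Sum>k\<in>UNIV. pmf \<rho> k * g k p)"

lemma profit_mixture:
  assumes "\<And>i. pmf q i = (\<Sum>m\<in>A. P m * pmf (qs m) i)"
  shows "profit v q c p = (\<Sum>m\<in>A. P m * profit v (qs m) c p)"
  unfolding profit_def demand_def assms
  by (simp add: sum_distrib_left sum.swap[of _ A] mult.left_commute)

text \<open>\<open>P m\<close> is the probability of \<open>m\<close>, \<open>qs m\<close> the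
  belief after it, and \<open>H i\<close> the payoff of type \<open>i\<close> before speaking.
  \<open>H_le\<close> rules out profitable deviations and \<open>H_eq\<close> holds for the senders
  of \<open>m\<close>. The prices following a message of the highest supported value turn out to be
  optimal after every message, hence also against the average belief.\<close>

lemma pool_messages:
  fixes \<rho> :: "'s::finite pmf" and q :: "'b::finite pmf" and A :: "'m set"
  assumes A: "finite A" and P: "\<And>m. m \<in> A \<Longrightarrow> 0 < P m"
    and mix: "\<And>i. pmf q i = (\<Sum>m\<in>A. P m * pmf (qs m) i)"
    and opt: "\<And>m k. m \<in> A \<Longrightarrow> k \<in> set_pmf \<rho> \<Longrightarrow> posts_optimally v (qs m) (c k) (g m k)"
    and H_le: "\<And>m i. m \<in> A \<Longrightarrow> surplus v \<rho> (g m) (v i) \<le> H i"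
    and H_eq: "\<And>m i. m \<in> A \<Longrightarrow> i \<in> set_pmf (qs m) \<Longrightarrow> surplus v \<rho> (g m) (v i) = H i"
  shows "\<exists>n\<in>A.
    (\<forall>k\<in>set_pmf \<rho>. posts_optimally v q (c k) (g n k) \<and>
      monopoly_profit v q (c k) = (\<Sum>m\<in>A. P m * monopoly_profit v (qs m) (c k))) \<and>
    (\<forall>i\<in>set_pmf q. surplus v \<rho> (g n) (v i) = H i)"
proof -
  have supp: "i \<in> set_pmf q \<longleftrightarrow> (\<exists>m\<in>A. i \<in> set_pmf (qs m))" for i
  proof -
    have "pmf q i = 0 \<longleftrightarrow> (\<forall>m\<in>A. P m * pmf (qs m) i = 0)"
      unfolding mix using A P by (subst sum_nonneg_eq_0_iff) (auto intro!: mult_nonneg_nonneg intro: less_imp_le)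
    then show ?thesis using P by (force simp: set_pmf_iff)
  qed
  \<comment> \<open>The pooled prices will be those after \<open>n\<close>, a message sent by a type
    with the highest supported value \<open>T\<close>.\<close>
  define T where "T = Max (v ` set_pmf q)"
  have "T \<in> v ` set_pmf q" unfolding T_def using set_pmf_not_empty by (intro Max_in) auto
  then obtain iT n where n: "n \<in> A" "iT \<in> set_pmf (qs n)" "T = v iT" using supp by auto
  have T_max: "v i \<le> T" if "i \<in> set_pmf q" for i
    unfolding T_def using that by (intro Max_ge) auto
  define w where "w m p = (\<Sum>k\<in>UNIV. pmf \<rho> k * g m k p)" for m p
  have surplus_w: "surplus v \<rho> (g m) = hinge_sum (range v) (w m)" for m
    by (simp add: surplus_def w_def[abs_def])
  have w_nonneg: "0 \<le> w m p" if "m \<in> A" for m p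
    unfolding w_def
  proof (rule sum_nonneg)
    fix k show "0 \<le> pmf \<rho> k * g m k p"
      using posts_optimallyD(1)[OF opt[OF that, of k], of p] by (cases "k \<in> set_pmf \<rho>") (auto simp: set_pmf_iff)
  qed
  \<comment> \<open>Prices posted after \<open>m\<close> are values of senders of \<open>m\<close>,
    so \<open>H_eq\<close> applies at every kink.\<close>
  have kink: "p \<in> v ` set_pmf (qs m)" if m: "m \<in> A" "w m p \<noteq> 0" for m p
  proof -
    obtain k where "pmf \<rho> k * g m k p \<noteq> 0"
      using m(2) unfolding w_def by (metis (no_types, lifting) sum.neutral)
    then show ?thesis using posts_optimallyD(2)[OF opt[OF m(1), of k], of p]
      by (auto simp: set_pmf_iff monopoly_price_def)
  qed
  have dominates: "surplus v \<rho> (g m') x \<le> surplus v \<rho> (g m) x"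
    if m: "m \<in> A" "m' \<in> A" "i \<in> set_pmf (qs m)" "x \<le> v i" for m m' i x
    unfolding surplus_w
  proof (rule hinge_sum_dominates[of _ _ _ "v i"])
    have le: "surplus v \<rho> (g m') (v j) \<le> surplus v \<rho> (g m) (v j)" if "j \<in> set_pmf (qs m)" for j
      using H_eq[OF m(1) that] H_le[OF m(2), of j] by simp
    show "hinge_sum (range v) (w m') (v i) \<le> hinge_sum (range v) (w m) (v i)"
      using le[OF m(3)] by (simp add: surplus_w)
    show "hinge_sum (range v) (w m') p \<le> hinge_sum (range v) (w m) p" if "w m p \<noteq> 0" for p
      using kink[OF m(1) that] le by (auto simp: surplus_w)
  qed (use m w_nonneg in auto)
  have transfer: "profit v (qs m) (c k) p = monopoly_profit v (qs m) (c k)"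
    if m: "m \<in> A" and k: "k \<in> set_pmf \<rho>" "g n k p \<noteq> 0" for m k p
  proof -
    define t where "t = Max (v ` set_pmf (qs m))"
    have t_in: "t \<in> v ` set_pmf (qs m)"
      unfolding t_def using set_pmf_not_empty by (intro Max_in) auto
    then obtain i where i: "i \<in> set_pmf (qs m)" "t = v i" by auto
    have t_max: "v j \<le> t" if "j \<in> set_pmf (qs m)" for j
      unfolding t_def using that by (intro Max_ge) auto
    have "t \<le> T" using T_max[of i] i supp m by auto
    \<comment> \<open>Up to the highest value \<open>t\<close> that sends \<open>m\<close>, the
      messages \<open>m\<close> and \<open>n\<close> dominate each other.\<close>
    have same: "surplus v \<rho> (g m) x = surplus v \<rho> (g n) x" if "x \<le> t" for x
      using dominates[OF m n(1) i(1), of x] dominates[OF n(1) m n(2), of x] that i n(3) \<open>t \<le> T\<close>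
      by simp
    show ?thesis
    proof (rule monopoly_price_transfer[where g = "g m" and g' = "g n" and c = c and k = k,
          OF opt[OF m] opt[OF n(1)] t_in t_max])
      show "(\<Sum>l\<in>UNIV. pmf \<rho> l * mass_below (range v) (g m l) x) =
          (\<Sum>l\<in>UNIV. pmf \<rho> l * mass_below (range v) (g n l) x)" if "x \<le> t" for x
      proof -
        have "mass_below (range v) (w m) x = mass_below (range v) (w n) x"
          using that same by (intro mass_below_eqI) (auto simp: surplus_w)
        then show ?thesis by (simp add: w_def[abs_def] mass_aggregate)
      qed
      show "(\<Sum>l\<in>UNIV. pmf \<rho> l * mass_upto (range v) (g m l) x) =
          (\<Sum>l\<in>UNIV. pmf \<rho> l * mass_upto (range v) (g n l) x)" if "x < t" for x
      proof -
        have "mass_upto (range v) (w m) x = mass_upto (range v) (w n) x"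
          using that same by (intro antisym mass_upto_leI[of _ _ t]) (auto simp: surplus_w)
        then show ?thesis by (simp add: w_def[abs_def] mass_aggregate)
      qed
      show "(\<Sum>l\<in>UNIV. pmf \<rho> l * mass_upto (range v) (g m l) t) \<le>
          (\<Sum>l\<in>UNIV. pmf \<rho> l * mass_upto (range v) (g n l) t)"
        if "j \<in> set_pmf (qs n)" "t < v j" for j
      proof -
        have "j \<in> set_pmf q" using supp n(1) that(1) by blast
        with T_max[of j] that(2) have "t < T" by simp
        then have "mass_upto (range v) (w m) t \<le> mass_upto (range v) (w n) t"
          using same[of t] dominates[OF n(1) m n(2)] n(3)
          by (intro mass_upto_leI[of _ _ T]) (auto simp: surplus_w)
        then show ?thesis by (simp add: w_def[abs_def] mass_aggregate)
      qed
    qed (use k in auto)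
  qed
  \<comment> \<open>Information cannot hurt the seller: profit is linear in the belief, so its
    maximum is convex.\<close>
  have mp_le: "monopoly_profit v q c' \<le> (\<Sum>m\<in>A. P m * monopoly_profit v (qs m) c')" for c'
    unfolding monopoly_profit_def[of v q]
  proof (subst Max_le_iff, safe)
    show "0 \<le> (\<Sum>m\<in>A. P m * monopoly_profit v (qs m) c')"
      using P monopoly_profit_nonneg by (intro sum_nonneg mult_nonneg_nonneg) (auto intro: less_imp_le)
    show "profit v q c' (v i) \<le> (\<Sum>m\<in>A. P m * monopoly_profit v (qs m) c')" for i
      unfolding profit_mixture[of q P qs A, OF mix]
      using P profit_le_monopoly_profit by (intro sum_mono mult_left_mono) (auto intro: less_imp_le)
  qed auto
  show ?thesis
  proof (rule bexI[OF _ n(1)], intro conjI[of "Ball _ _"] ballI)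
    fix k assume k: "k \<in> set_pmf \<rho>"
    show "posts_optimally v q (c k) (g n k) \<and>
      monopoly_profit v q (c k) = (\<Sum>m\<in>A. P m * monopoly_profit v (qs m) (c k))"
    proof (cases "c k < T")
      case True
      \<comment> \<open>A price posted after \<open>n\<close> earns the average of the monopoly
        profits, which is an upper bound by \<open>mp_le\<close>, so it is optimal against
        \<open>q\<close>.\<close>
      have prices: "profit v q (c k) p = (\<Sum>m\<in>A. P m * monopoly_profit v (qs m) (c k)) \<and>
        profit v q (c k) p = monopoly_profit v q (c k)" if "g n k p \<noteq> 0" for p
      proof -
        have "profit v q (c k) p = (\<Sum>m\<in>A. P m * monopoly_profit v (qs m) (c k))"
          unfolding profit_mixture[of q P qs A, OF mix] using transfer k that by simp
        with mp_le[of "c k"] profit_le_monopoly_profit[of v q "c k" p] show ?thesis by simp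
      qed
      have iT: "iT \<in> set_pmf q" "c k < v iT" using n supp True by auto
      then have pos: "0 < monopoly_profit v q (c k)" by (auto simp: monopoly_profit_pos_iff)
      have sum1: "sum (g n k) (range v) = 1"
        using posts_optimallyD(4)[OF opt[OF n(1) k] n(2)] iT by simp
      then obtain p where "g n k p \<noteq> 0" by (metis sum.neutral zero_neq_one)
      moreover have "posts_optimally v q (c k) (g n k)"
        unfolding posts_optimally_def using iT sum1 posts_optimallyD(1)[OF opt[OF n(1) k]]
          prices pos by (auto intro!: monopoly_priceI)
      ultimately show ?thesis using prices by fastforce
    next
      case False
      \<comment> \<open>A cost of at least \<open>T\<close> leaves no profitable sale, with or
        without the message.\<close>
      have none: "\<not> (\<exists>i\<in>set_pmf q. c k < v i)" using False T_max by force
      then have none_m: "\<not> (\<exists>i\<in>set_pmf (qs m). c k < v i)" if "m \<in> A" for m using supp that by blast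
      have "monopoly_profit v (qs m) (c k) = 0" if "m \<in> A" for m
        using none_m[OF that] monopoly_profit_nonneg[of v "qs m" "c k"]
        by (simp add: monopoly_profit_pos_iff[symmetric])
      moreover have "monopoly_profit v q (c k) = 0"
        using none monopoly_profit_nonneg[of v q "c k"] by (simp add: monopoly_profit_pos_iff[symmetric])
      moreover have "posts_optimally v q (c k) (g n k)"
        using none none_m[OF n(1)] opt[OF n(1) k] by (simp add: posts_optimally_def)
      ultimately show ?thesis by simp
    qed
  next
    fix i assume "i \<in> set_pmf q"
    then obtain m where m: "m \<in> A" "i \<in> set_pmf (qs m)" using supp by auto
    have "H i = surplus v \<rho> (g m) (v i)" using H_eq[OF m] by simp
    also have "\<dots> \<le> surplus v \<rho> (g n) (v i)"
      using dominates[OF n(1) m(1) n(2)] T_max[OF \<open>i \<in> set_pmf q\<close>] n(3) by simp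
    finally show "surplus v \<rho> (g n) (v i) = H i" using H_le[OF n(1), of i] by simp
  qed
qed

subsection \<open>Values along the histories of an equilibrium\<close>

lemma finite_histories: "finite (histories M R)"
proof -
  have "histories M R = {h. set h \<subseteq> {1..M} \<and> length h \<le> R}" by (auto simp: histories_def)
  then show ?thesis by (simp add: finite_lists_length_le)
qed

lemma histories_append:
  "h \<in> histories M R \<Longrightarrow> length h < R \<Longrightarrow> m \<in> {1..M} \<Longrightarrow> h @ [m] \<in> histories M R"
  by (auto simp: histories_def)

section \<open>The distribution of the talk\<close>

lemma set_pmf_message:
  assumes "is_buyer_strategy M R b" "is_seller_strategy M R s" "h \<in> histories M R" "length h < R"
  shows "set_pmf (if even (R - length h) then seller_msg s h else buyer_msg b h) \<subseteq> {1..M}"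
proof (cases "even (R - length h)")
  case True
  then have "seller_turn R h" unfolding seller_turn_def using assms(4) by blast
  with True assms(2,3) show ?thesis unfolding is_seller_strategy_def if_P[OF True] by blast
next
  case False
  then have "buyer_turn R h" unfolding buyer_turn_def using assms(4) by blast
  with False assms(1,3) show ?thesis unfolding is_buyer_strategy_def if_not_P[OF False] by blast
qed

text \<open>Strategies are constrained on \<open>histories M R\<close> only, so play has to be
  confined to complete legal histories before prices and acceptance can be evaluated.\<close>

lemma set_pmf_talk:
  assumes "is_buyer_strategy M R b" "is_seller_strategy M R s" "h \<in> histories M R"
  shows "set_pmf (talk (R - length h) b s h) \<subseteq> {h'\<in>histories M R. length h' = R}"
  using assms(3)
proof (induction "R - length h" arbitrary: h)
  case 0
  then show ?case by (auto simp: histories_def)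
next
  case (Suc r)
  then have len: "length h < R" by simp
  have msg: "set_pmf (if even (Suc r) then seller_msg s h else buyer_msg b h) \<subseteq> {1..M}"
    using set_pmf_message[OF assms(1,2) Suc.prems len] unfolding Suc.hyps(2) .
  have step: "set_pmf (talk r b s (h @ [m])) \<subseteq> {h'\<in>histories M R. length h' = R}"
    if "m \<in> set_pmf (if even (Suc r) then seller_msg s h else buyer_msg b h)" for m
  proof -
    have "m \<in> {1..M}" using that msg by blast
    moreover have "r = R - length (h @ [m])" using Suc.hyps(2) by simp
    ultimately show ?thesis using Suc.hyps(1)[of "h @ [m]"] Suc.prems len histories_append by simp
  qed
  show ?case unfolding Suc.hyps(2)[symmetric] talk.simps set_bind_pmf
    using step by (intro UN_least)
qed

lemma finite_set_pmf_talk: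
  assumes "is_buyer_strategy M R b" "is_seller_strategy M R s" "h \<in> histories M R"
  shows "finite (set_pmf (talk (R - length h) b s h))"
  using set_pmf_talk[OF assms] by (rule finite_subset) (simp add: finite_histories)

text \<open>This discards a one-shot deviation once its history has passed, and identifies the talk
  of buyers who send the same messages.\<close>

lemma talk_cong:
  assumes "\<And>h'. length h \<le> length h' \<Longrightarrow> buyer_msg b h' = buyer_msg b' h'"
  shows "talk r b s h = talk r b' s h"
  using assms
proof (induction r arbitrary: h)
  case (Suc r)
  have "talk r b s (h @ [m]) = talk r b' s (h @ [m])" for m
    using Suc.prems by (intro Suc.IH) simp
  then show ?case using Suc.prems[of h] by simp
qed simp

lemma expectation_talk_step:
  fixes F :: "nat list \<Rightarrow> real"
  assumes "is_buyer_strategy M R b" "is_seller_strategy M R s" "h \<in> histories M R" "length h < R"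
  shows "measure_pmf.expectation (talk (R - length h) b s h) F =
    (\<Sum>m\<in>{1..M}. pmf (if even (R - length h) then seller_msg s h else buyer_msg b h) m *
      measure_pmf.expectation (talk (R - length (h @ [m])) b s (h @ [m])) F)"
proof -
  obtain r where r: "R - length h = Suc r" using assms(4) by (cases "R - length h") auto
  then have r': "R - length (h @ [m]) = r" for m by simp
  have "set_pmf (if even (Suc r) then seller_msg s h else buyer_msg b h) \<subseteq> {1..M}"
    using set_pmf_message[OF assms] unfolding r .
  moreover have "finite (set_pmf (talk r b s (h @ [m])))" if "m \<in> {1..M}" for m
    using finite_set_pmf_talk[OF assms(1,2) histories_append[OF assms(3,4) that]] r' by simp
  ultimately show ?thesis
    unfolding r' unfolding r talk.simps by (subst pmf_expectation_bind[of "{1..M}"]) auto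
qed

section \<open>Bayesian updates, mixtures and price integrals\<close>

lemma expectation_finite_type:
  fixes q :: "'t::finite pmf" and f :: "'t \<Rightarrow> real"
  shows "measure_pmf.expectation q f = (\<Sum>t\<in>UNIV. pmf q t * f t)"
  by (subst integral_measure_pmf_real[of UNIV]) (auto simp: mult.commute)

lemma sum_pmf_finite_type: "(\<Sum>t\<in>UNIV. pmf q t) = 1" for q :: "'t::finite pmf"
  by (rule sum_pmf_eq_1) auto

text \<open>Multiplied out, Bayes' rule also covers messages of probability 0: both sides vanish
  although \<open>q'\<close> is arbitrary.\<close>

lemma bayes_updateD:
  assumes "bayes_update q L q'" "\<And>t. 0 \<le> L t"
  shows "(\<Sum>t'\<in>UNIV. pmf q t' * L t') * pmf q' t = pmf q t * L t"
proof (cases "(\<Sum>t'\<in>UNIV. pmf q t' * L t') > 0")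
  case True
  then show ?thesis using assms(1) by (simp add: bayes_update_def)
next
  case False
  then have 0: "(\<Sum>t'\<in>UNIV. pmf q t' * L t') = 0"
    using assms(2) by (meson antisym not_le pmf_nonneg sum_nonneg mult_nonneg_nonneg)
  then have "pmf q t * L t = 0" using assms(2) by (subst (asm) sum_nonneg_eq_0_iff) auto
  with 0 show ?thesis by simp
qed

text \<open>Optimal posting rules form a convex set. Weight 0 is exempt because a type may be
  excluded by the buyer's belief after a message that it never sends.\<close>

lemma posts_optimally_mixture:
  assumes "finite A" "\<And>m. m \<in> A \<Longrightarrow> 0 \<le> a m" "sum a A = 1"
    and opt: "\<And>m. m \<in> A \<Longrightarrow> a m \<noteq> 0 \<Longrightarrow> posts_optimally v q c (g m)"
  shows "posts_optimally v q c (\<lambda>p. \<Sum>m\<in>A. a m * g m p)"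
proof (cases "\<exists>i\<in>set_pmf q. c < v i")
  case True
  have "0 \<le> a m * g m p" if "m \<in> A" for m p
    using assms(2)[OF that] posts_optimallyD(1)[OF opt[OF that]] by (cases "a m = 0") auto
  then have "0 \<le> (\<Sum>m\<in>A. a m * g m p)" for p by (intro sum_nonneg)
  moreover have "monopoly_price v q c p" if "(\<Sum>m\<in>A. a m * g m p) \<noteq> 0" for p
  proof -
    obtain m where "m \<in> A" "a m * g m p \<noteq> 0" using \<open>(\<Sum>m\<in>A. a m * g m p) \<noteq> 0\<close> by (meson sum.neutral)
    then show ?thesis using posts_optimallyD(2)[OF opt] by auto
  qed
  moreover have "(\<Sum>p\<in>range v. \<Sum>m\<in>A. a m * g m p) = 1"
  proof -
    have "(\<Sum>p\<in>range v. \<Sum>m\<in>A. a m * g m p) = (\<Sum>m\<in>A. a m * sum (g m) (range v))"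
      by (subst sum.swap) (simp add: sum_distrib_left)
    also have "\<dots> = sum a A"
    proof (rule sum.cong)
      fix m assume "m \<in> A"
      then show "a m * sum (g m) (range v) = a m"
        using True posts_optimallyD(4)[OF opt, of m] by (cases "a m = 0") auto
    qed simp
    finally show ?thesis using assms(3) by simp
  qed
  ultimately show ?thesis using True by (auto simp: posts_optimally_def)
next
  case False
  have "a m * g m p = 0" if "m \<in> A" for m p
    using opt[OF that] False by (cases "a m = 0") (auto simp: posts_optimally_def)
  then have "(\<Sum>m\<in>A. a m * g m p) = 0" for p by (intro sum.neutral) auto
  with False show ?thesis by (auto simp: posts_optimally_def)
qed

lemma hinge_sum_mixture:
  "hinge_sum V (\<lambda>p. \<Sum>m\<in>A. a m * w m p) x = (\<Sum>m\<in>A. a m * hinge_sum V (w m) x)"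
  by (simp add: hinge_sum_def sum_distrib_left sum_distrib_right sum.swap[of _ A] mult.assoc)

text \<open>Equilibrium prices of a seller with a profitable sale almost surely lie in a finite set;
  this turns their Borel distribution into finitely many point masses.\<close>

lemma integral_finite_support:
  fixes f :: "ennreal \<Rightarrow> real"
  assumes "prob_space N" "sets N = sets borel" "finite F" "AE p in N. p \<in> F"
    and "f \<in> borel_measurable borel"
  shows "(\<integral>p. f p \<partial>N) = (\<Sum>p\<in>F. measure N {p} * f p)"
proof -
  interpret prob_space N by fact
  have [measurable_cong]: "sets N = sets borel" by fact
  have [measurable]: "f \<in> borel_measurable borel" by fact
  have "(\<integral>p. f p \<partial>N) = (\<integral>p. (\<Sum>x\<in>F. indicator {x} p * f x) \<partial>N)"
  proof (rule integral_cong_AE)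
    show "AE p in N. f p = (\<Sum>x\<in>F. indicator {x} p * f x)"
      using assms(4)
    proof eventually_elim
      case (elim p)
      have "(\<Sum>x\<in>F. indicator {x} p * f x) = (\<Sum>x\<in>F. if p = x then f x else 0)"
        by (intro sum.cong) (auto simp: indicator_def)
      with elim \<open>finite F\<close> show ?case by simp
    qed
  qed measurable
  also have "\<dots> = (\<Sum>x\<in>F. measure N {x} * f x)"
    using assms(2)
    by (subst Bochner_Integration.integral_sum)
       (auto simp: sets_eq_imp_space_eq[OF assms(2)] less_top[symmetric])
  finally show ?thesis .
qed

section \<open>Continuation values in a fixed equilibrium\<close>

locale cheap_talk_equilibrium =
  fixes M R :: nat
    and v :: "'b::finite \<Rightarrow> real" and c :: "'s::finite \<Rightarrow> real"
    and \<mu> :: "'b pmf" and \<nu> :: "'s pmf"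
    and E :: "('b, 's) assessment"
  assumes v_nonneg: "0 \<le> v i" and c_nonneg: "0 \<le> c k"
    and equilibrium: "equilibrium M R v c \<mu> \<nu> E"
begin

abbreviation "B \<equiv> buyer_strat E"
abbreviation "S \<equiv> seller_strat E"
abbreviation "\<rho> \<equiv> buyer_belief E"
abbreviation "q \<equiv> seller_belief E"

definition buyer_eq_value :: "'b \<Rightarrow> nat list \<Rightarrow> real" where
  "buyer_eq_value i h = buyer_value R (v i) (\<rho> h) (B i) S h"

definition seller_eq_value :: "'s \<Rightarrow> nat list \<Rightarrow> real" where
  "seller_eq_value k h = seller_value R (c k) (q h) B (S k) h"

text \<open>The invariant of the backward induction. Equality is confined to the support of
  \<open>q h\<close>, since a seller type without a profitable sale may post prices that only
  excluded buyer types accept. The inequality for all types becomes \<open>H_le\<close> in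
  \<open>pool_messages\<close>.\<close>

definition pooled :: "nat list \<Rightarrow> ('s \<Rightarrow> real \<Rightarrow> real) \<Rightarrow> bool" where
  "pooled h g \<longleftrightarrow>
     (\<forall>k\<in>set_pmf (\<rho> h). posts_optimally v (q h) (c k) (g k) \<and>
        seller_eq_value k h = monopoly_profit v (q h) (c k)) \<and>
     (\<forall>i. surplus v (\<rho> h) g (v i) \<le> buyer_eq_value i h) \<and>
     (\<forall>i\<in>set_pmf (q h). surplus v (\<rho> h) g (v i) = buyer_eq_value i h)"

lemma strategies: "is_buyer_strategy M R (B i)" "is_seller_strategy M R (S k)"
  using equilibrium by (auto simp: equilibrium_def)

lemma sequential: "sequentially_rational M R v c E"
  using equilibrium by (simp add: equilibrium_def)

lemma bayes: "bayes_consistent M R \<mu> \<nu> E"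
  using equilibrium by (simp add: equilibrium_def)

lemma buyer_value_buyer_turn:
  assumes "is_buyer_strategy M R b" "h \<in> histories M R" "buyer_turn R h"
  shows "buyer_value R x \<rho>' b S h =
    (\<Sum>m\<in>{1..M}. pmf (buyer_msg b h) m * buyer_value R x \<rho>' b S (h @ [m]))"
proof -
  have "buyer_cont_payoff R x b (S k) h =
      (\<Sum>m\<in>{1..M}. pmf (buyer_msg b h) m * buyer_cont_payoff R x b (S k) (h @ [m]))" for k
    using assms unfolding buyer_cont_payoff_def buyer_turn_def
    by (subst expectation_talk_step[OF assms(1) strategies(2)]) auto
  then show ?thesis
    by (simp add: buyer_value_def expectation_finite_type sum_distrib_left sum.swap[of _ UNIV]
        mult.left_commute)
qed

text \<open>Bayes' rule exchanges drawing type first and message second for the opposite order; the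
  form of \<open>update\<close> allows \<open>P m = 0\<close>.\<close>

lemma buyer_eq_value_seller_turn:
  assumes h: "h \<in> histories M R" "seller_turn R h"
    and update: "\<And>m k. m \<in> {1..M} \<Longrightarrow>
      P m * pmf (\<rho> (h @ [m])) k = pmf (\<rho> h) k * pmf (seller_msg (S k) h) m"
  shows "buyer_eq_value i h = (\<Sum>m\<in>{1..M}. P m * buyer_eq_value i (h @ [m]))"
proof -
  let ?u = "\<lambda>k h. buyer_cont_payoff R (v i) (B i) (S k) h"
  have "?u k h = (\<Sum>m\<in>{1..M}. pmf (seller_msg (S k) h) m * ?u k (h @ [m]))" for k
    using h unfolding buyer_cont_payoff_def seller_turn_def
    by (subst expectation_talk_step[OF strategies]) auto
  then have "buyer_eq_value i h =
      (\<Sum>k\<in>UNIV. \<Sum>m\<in>{1..M}. pmf (\<rho> h) k * pmf (seller_msg (S k) h) m * ?u k (h @ [m]))"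
    by (simp add: buyer_eq_value_def buyer_value_def expectation_finite_type sum_distrib_left mult.assoc)
  also have "\<dots> = (\<Sum>m\<in>{1..M}. \<Sum>k\<in>UNIV. P m * pmf (\<rho> (h @ [m])) k * ?u k (h @ [m]))"
    by (subst sum.swap) (simp add: update)
  also have "\<dots> = (\<Sum>m\<in>{1..M}. P m * buyer_eq_value i (h @ [m]))"
    by (simp add: buyer_eq_value_def buyer_value_def expectation_finite_type sum_distrib_left mult.assoc)
  finally show ?thesis .
qed

lemma seller_eq_value_buyer_turn:
  assumes h: "h \<in> histories M R" "buyer_turn R h"
    and update: "\<And>m i. m \<in> {1..M} \<Longrightarrow>
      P m * pmf (q (h @ [m])) i = pmf (q h) i * pmf (buyer_msg (B i) h) m"
  shows "seller_eq_value k h = (\<Sum>m\<in>{1..M}. P m * seller_eq_value k (h @ [m]))"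
proof -
  let ?u = "\<lambda>i h. seller_cont_payoff R (c k) (B i) (S k) h"
  have "?u i h = (\<Sum>m\<in>{1..M}. pmf (buyer_msg (B i) h) m * ?u i (h @ [m]))" for i
    using h unfolding seller_cont_payoff_def buyer_turn_def
    by (subst expectation_talk_step[OF strategies]) auto
  then have "seller_eq_value k h =
      (\<Sum>i\<in>UNIV. \<Sum>m\<in>{1..M}. pmf (q h) i * pmf (buyer_msg (B i) h) m * ?u i (h @ [m]))"
    by (simp add: seller_eq_value_def seller_value_def expectation_finite_type sum_distrib_left mult.assoc)
  also have "\<dots> = (\<Sum>m\<in>{1..M}. \<Sum>i\<in>UNIV. P m * pmf (q (h @ [m])) i * ?u i (h @ [m]))"
    by (subst sum.swap) (simp add: update)
  also have "\<dots> = (\<Sum>m\<in>{1..M}. P m * seller_eq_value k (h @ [m]))"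
    by (simp add: seller_eq_value_def seller_value_def expectation_finite_type sum_distrib_left mult.assoc)
  finally show ?thesis .
qed

text \<open>The seller knows her own type, so the weights are her own message probabilities and no
  update enters.\<close>

lemma seller_eq_value_seller_turn:
  assumes h: "h \<in> histories M R" "seller_turn R h"
    and same: "\<And>m. m \<in> {1..M} \<Longrightarrow> q (h @ [m]) = q h"
  shows "seller_eq_value k h =
    (\<Sum>m\<in>{1..M}. pmf (seller_msg (S k) h) m * seller_eq_value k (h @ [m]))"
proof -
  have "seller_cont_payoff R (c k) (B i) (S k) h =
      (\<Sum>m\<in>{1..M}. pmf (seller_msg (S k) h) m * seller_cont_payoff R (c k) (B i) (S k) (h @ [m]))" for i
    using h unfolding seller_cont_payoff_def seller_turn_def
    by (subst expectation_talk_step[OF strategies]) auto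
  then show ?thesis
    by (simp add: seller_eq_value_def seller_value_def expectation_finite_type same sum_distrib_left
        sum.swap[of _ UNIV] mult.left_commute)
qed

lemma buyer_message_optimal:
  assumes h: "h \<in> histories M R" "buyer_turn R h" and m: "m \<in> {1..M}"
    and same: "\<rho> (h @ [m]) = \<rho> h"
  shows "buyer_eq_value i (h @ [m]) \<le> buyer_eq_value i h"
proof -
  \<comment> \<open>The one-shot deviation: send \<open>m\<close> for sure at \<open>h\<close> and
    follow \<open>B i\<close> otherwise.\<close>
  define b where "b = (B i)\<lparr>buyer_msg := (buyer_msg (B i))(h := return_pmf m)\<rparr>"
  have b: "is_buyer_strategy M R b"
    using strategies(1)[of i] m by (auto simp: b_def is_buyer_strategy_def)
  \<comment> \<open>Only histories longer than \<open>h\<close> are still to come, where the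
    deviation coincides with \<open>B i\<close>.\<close>
  have "talk r b s (h @ [m]) = talk r (B i) s (h @ [m])" for r s
    by (rule talk_cong) (auto simp: b_def)
  then have "buyer_eq_value i (h @ [m]) = buyer_value R (v i) (\<rho> h) b S (h @ [m])"
    by (simp add: buyer_eq_value_def buyer_value_def buyer_cont_payoff_def same b_def)
  also have "\<dots> = buyer_value R (v i) (\<rho> h) b S h"
    using m by (subst buyer_value_buyer_turn[OF b h]) (simp add: b_def indicator_def if_distrib sum.delta)
  also have "\<dots> \<le> buyer_eq_value i h"
    using sequential h(1) b by (simp add: sequentially_rational_def buyer_eq_value_def)
  finally show ?thesis .
qed

section \<open>Backward induction through one message\<close>

lemma sum_message_probs:
  assumes "set_pmf p \<subseteq> {1..M}"
  shows "(\<Sum>m\<in>{1..M}. pmf p m) = 1"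
  using assms by (intro sum_pmf_eq_1) auto

text \<open>Optimality of the buyer's message supplies \<open>H_le\<close> and \<open>H_eq\<close>
  of \<open>pool_messages\<close>, and Bayes' rule supplies the mixture of beliefs.\<close>

lemma pooled_buyer_turn:
  assumes h: "h \<in> histories M R" "buyer_turn R h"
    and IH: "\<And>m. m \<in> {1..M} \<Longrightarrow> \<exists>g. pooled (h @ [m]) g"
  shows "\<exists>g. pooled h g"
proof -
  let ?\<beta> = "\<lambda>i m. pmf (buyer_msg (B i) h) m"
  define P where "P m = (\<Sum>i\<in>UNIV. pmf (q h) i * ?\<beta> i m)" for m
  \<comment> \<open>Messages of probability 0 are left out, as the belief after them is
    arbitrary.\<close>
  define A where "A = {m\<in>{1..M}. 0 < P m}"
  have P_nonneg: "0 \<le> P m" for m unfolding P_def by (intro sum_nonneg) auto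
  have \<beta>1: "(\<Sum>m\<in>{1..M}. ?\<beta> i m) = 1" for i
    using strategies(1)[of i] h by (intro sum_message_probs) (auto simp: is_buyer_strategy_def)
  have same: "\<rho> (h @ [m]) = \<rho> h" if "m \<in> {1..M}" for m
    using bayes h that by (auto simp: bayes_consistent_def)
  have update: "P m * pmf (q (h @ [m])) i = pmf (q h) i * ?\<beta> i m" if "m \<in> {1..M}" for m i
  proof -
    have "bayes_update (q h) (\<lambda>i. ?\<beta> i m) (q (h @ [m]))"
      using bayes h that by (auto simp: bayes_consistent_def)
    from bayes_updateD[OF this] show ?thesis by (simp add: P_def)
  qed
  have on_A: "(\<Sum>m\<in>A. P m * f m) = (\<Sum>m\<in>{1..M}. P m * f m)" for f :: "nat \<Rightarrow> real"
    unfolding A_def using P_nonneg by (intro sum.mono_neutral_left) (auto simp: less_le)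
  obtain g where g: "\<And>m. m \<in> {1..M} \<Longrightarrow> pooled (h @ [m]) (g m)" using IH by metis
  have H_le: "surplus v (\<rho> h) (g m) (v i) \<le> buyer_eq_value i h" if "m \<in> A" for m i
  proof -
    have m: "m \<in> {1..M}" using that by (simp add: A_def)
    have "surplus v (\<rho> h) (g m) (v i) \<le> buyer_eq_value i (h @ [m])"
      using g[OF m] same[OF m] by (simp add: pooled_def)
    also have "\<dots> \<le> buyer_eq_value i h" by (rule buyer_message_optimal[OF h m same[OF m]])
    finally show ?thesis .
  qed
  have H_eq: "surplus v (\<rho> h) (g m) (v i) = buyer_eq_value i h"
    if m: "m \<in> A" "i \<in> set_pmf (q (h @ [m]))" for m i
  proof -
    have mM: "m \<in> {1..M}" "0 < P m" using m by (auto simp: A_def)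
    then have "pmf (q h) i * ?\<beta> i m \<noteq> 0" using update[OF mM(1), of i, symmetric] m(2) by (simp add: set_pmf_iff)
    then have \<beta>: "?\<beta> i m \<noteq> 0" by simp
    \<comment> \<open>A type is indifferent among the messages that it sends: its losses are
      nonnegative and average to 0.\<close>
    have "(\<Sum>m\<in>{1..M}. ?\<beta> i m * (buyer_eq_value i h - buyer_eq_value i (h @ [m]))) =
        buyer_eq_value i h - (\<Sum>m\<in>{1..M}. ?\<beta> i m * buyer_eq_value i (h @ [m]))"
      using \<beta>1[of i] by (simp add: right_diff_distrib sum_subtractf sum_distrib_right[symmetric])
    also have "(\<Sum>m\<in>{1..M}. ?\<beta> i m * buyer_eq_value i (h @ [m])) = buyer_eq_value i h"
      using buyer_value_buyer_turn[OF strategies(1) h, of "v i" "\<rho> h" i]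
      by (simp add: buyer_eq_value_def same)
    finally have "(\<Sum>m\<in>{1..M}. ?\<beta> i m * (buyer_eq_value i h - buyer_eq_value i (h @ [m]))) = 0"
      by simp
    then have "\<forall>m\<in>{1..M}. ?\<beta> i m * (buyer_eq_value i h - buyer_eq_value i (h @ [m])) = 0"
      using buyer_message_optimal[OF h _ same] by (subst (asm) sum_nonneg_eq_0_iff) auto
    then have "buyer_eq_value i h = buyer_eq_value i (h @ [m])" using \<beta> mM(1) by auto
    then show ?thesis using g[OF mM(1)] m(2) same[OF mM(1)] by (simp add: pooled_def)
  qed
  have mix: "pmf (q h) i = (\<Sum>m\<in>A. P m * pmf (q (h @ [m])) i)" for i
    using \<beta>1[of i] by (simp add: on_A update sum_distrib_left[symmetric])
  have opt: "posts_optimally v (q (h @ [m])) (c k) (g m k)" if "m \<in> A" "k \<in> set_pmf (\<rho> h)" for m k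
    using g[of m] that same[of m] by (auto simp: A_def pooled_def)
  have finA: "finite A" by (simp add: A_def)
  have posA: "0 < P m" if "m \<in> A" for m using that by (simp add: A_def)
  obtain n where n: "n \<in> A"
    "\<And>k. k \<in> set_pmf (\<rho> h) \<Longrightarrow> posts_optimally v (q h) (c k) (g n k)"
    "\<And>k. k \<in> set_pmf (\<rho> h) \<Longrightarrow> monopoly_profit v (q h) (c k) =
      (\<Sum>m\<in>A. P m * monopoly_profit v (q (h @ [m])) (c k))"
    "\<And>i. i \<in> set_pmf (q h) \<Longrightarrow> surplus v (\<rho> h) (g n) (v i) = buyer_eq_value i h"
    using pool_messages[OF finA posA mix opt H_le H_eq] by blast
  have "seller_eq_value k h = monopoly_profit v (q h) (c k)" if k: "k \<in> set_pmf (\<rho> h)" for k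
  proof -
    have "seller_eq_value k h = (\<Sum>m\<in>{1..M}. P m * seller_eq_value k (h @ [m]))"
      by (rule seller_eq_value_buyer_turn[OF h update])
    also have "\<dots> = (\<Sum>m\<in>{1..M}. P m * monopoly_profit v (q (h @ [m])) (c k))"
      using g k same by (intro sum.cong) (auto simp: pooled_def)
    finally show ?thesis using n(3)[OF k] by (simp add: on_A)
  qed
  then have "pooled h (g n)" using n(1,2,4) H_le by (auto simp: pooled_def)
  then show ?thesis by blast
qed

text \<open>Her message leaves the seller's belief and hence her optimal prices unchanged, so the
  prices of each type can be averaged over its own messages.\<close>

lemma pooled_seller_turn:
  assumes h: "h \<in> histories M R" "seller_turn R h"
    and IH: "\<And>m. m \<in> {1..M} \<Longrightarrow> \<exists>g. pooled (h @ [m]) g"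
  shows "\<exists>g. pooled h g"
proof -
  let ?\<sigma> = "\<lambda>k m. pmf (seller_msg (S k) h) m"
  define P where "P m = (\<Sum>k\<in>UNIV. pmf (\<rho> h) k * ?\<sigma> k m)" for m
  have P_nonneg: "0 \<le> P m" for m unfolding P_def by (intro sum_nonneg) auto
  have \<sigma>1: "(\<Sum>m\<in>{1..M}. ?\<sigma> k m) = 1" for k
    using strategies(2)[of k] h by (intro sum_message_probs) (auto simp: is_seller_strategy_def)
  have same: "q (h @ [m]) = q h" if "m \<in> {1..M}" for m
    using bayes h that by (auto simp: bayes_consistent_def)
  have update: "P m * pmf (\<rho> (h @ [m])) k = pmf (\<rho> h) k * ?\<sigma> k m" if "m \<in> {1..M}" for m k
  proof -
    have "bayes_update (\<rho> h) (\<lambda>k. ?\<sigma> k m) (\<rho> (h @ [m]))"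
      using bayes h that by (auto simp: bayes_consistent_def)
    from bayes_updateD[OF this] show ?thesis by (simp add: P_def)
  qed
  \<comment> \<open>A type survives in the buyer's belief after each message that it may send, so
    \<open>pooled\<close> speaks about it there.\<close>
  have supp: "k \<in> set_pmf (\<rho> (h @ [m]))"
    if "m \<in> {1..M}" "k \<in> set_pmf (\<rho> h)" "?\<sigma> k m \<noteq> 0" for m k
    using update[of m k] that by (auto simp: set_pmf_iff)
  obtain g where g: "\<And>m. m \<in> {1..M} \<Longrightarrow> pooled (h @ [m]) (g m)" using IH by metis
  define g' where "g' k p = (\<Sum>m\<in>{1..M}. ?\<sigma> k m * g m k p)" for k p
  have opt: "posts_optimally v (q h) (c k) (g' k)" if k: "k \<in> set_pmf (\<rho> h)" for k
    unfolding g'_def[abs_def]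
  proof (rule posts_optimally_mixture)
    show "posts_optimally v (q h) (c k) (g m k)" if "m \<in> {1..M}" "?\<sigma> k m \<noteq> 0" for m
      using g[OF that(1)] supp[OF that(1) k that(2)] same[OF that(1)] by (auto simp: pooled_def)
  qed (use \<sigma>1 in auto)
  have val: "seller_eq_value k h = monopoly_profit v (q h) (c k)" if k: "k \<in> set_pmf (\<rho> h)" for k
  proof -
    have "seller_eq_value k h = (\<Sum>m\<in>{1..M}. ?\<sigma> k m * seller_eq_value k (h @ [m]))"
      by (rule seller_eq_value_seller_turn[OF h same])
    also have "\<dots> = (\<Sum>m\<in>{1..M}. ?\<sigma> k m * monopoly_profit v (q h) (c k))"
    proof (rule sum.cong)
      fix m assume m: "m \<in> {1..M}"
      show "?\<sigma> k m * seller_eq_value k (h @ [m]) = ?\<sigma> k m * monopoly_profit v (q h) (c k)"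
        using g[OF m] supp[OF m k] same[OF m] by (cases "?\<sigma> k m = 0") (auto simp: pooled_def)
    qed simp
    also have "\<dots> = monopoly_profit v (q h) (c k)"
      using \<sigma>1[of k] by (simp add: sum_distrib_right[symmetric])
    finally show ?thesis .
  qed
  have surplus: "surplus v (\<rho> h) g' x = (\<Sum>m\<in>{1..M}. P m * surplus v (\<rho> (h @ [m])) (g m) x)" for x
  proof -
    have "(\<Sum>k\<in>UNIV. pmf (\<rho> h) k * g' k p) =
        (\<Sum>m\<in>{1..M}. P m * (\<Sum>k\<in>UNIV. pmf (\<rho> (h @ [m])) k * g m k p))" for p
    proof -
      have "(\<Sum>k\<in>UNIV. pmf (\<rho> h) k * g' k p) =
          (\<Sum>m\<in>{1..M}. \<Sum>k\<in>UNIV. pmf (\<rho> h) k * ?\<sigma> k m * g m k p)"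
        by (subst sum.swap) (simp add: g'_def sum_distrib_left mult.assoc)
      also have "\<dots> = (\<Sum>m\<in>{1..M}. P m * (\<Sum>k\<in>UNIV. pmf (\<rho> (h @ [m])) k * g m k p))"
        by (simp add: update[symmetric] sum_distrib_left mult.assoc)
      finally show ?thesis .
    qed
    then show ?thesis unfolding surplus_def by (simp only: hinge_sum_mixture)
  qed
  have buyer: "buyer_eq_value i h = (\<Sum>m\<in>{1..M}. P m * buyer_eq_value i (h @ [m]))" for i
    by (rule buyer_eq_value_seller_turn[OF h update])
  have "surplus v (\<rho> h) g' (v i) \<le> buyer_eq_value i h" for i
    unfolding surplus buyer using g P_nonneg by (intro sum_mono mult_left_mono) (auto simp: pooled_def)
  moreover have "surplus v (\<rho> h) g' (v i) = buyer_eq_value i h" if "i \<in> set_pmf (q h)" for i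
    unfolding surplus buyer using g same that by (intro sum.cong) (auto simp: pooled_def)
  ultimately have "pooled h g'" using opt val by (auto simp: pooled_def)
  then show ?thesis by blast
qed

section \<open>The end of the talk: acceptance and posted prices\<close>

lemma accept_measurable:
  assumes "h \<in> histories M R" "length h = R"
  shows "accept (B i) h \<in> borel_measurable borel"
  using strategies(1)[of i] assms by (simp add: is_buyer_strategy_def)

lemma accept_bounds:
  assumes "h \<in> histories M R" "length h = R"
  shows "0 \<le> accept (B i) h p" "accept (B i) h p \<le> 1" "accept (B i) h \<top> = 0"
  using strategies(1)[of i] assms by (auto simp: is_buyer_strategy_def)

lemma accept_optimal:
  assumes "h \<in> histories M R" "length h = R" "p \<noteq> \<top>" "a \<in> {0..1}"
  shows "a * (v i - enn2real p) \<le> accept (B i) h p * (v i - enn2real p)"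
proof -
  have "\<forall>h\<in>histories M R. length h = R \<longrightarrow> (\<forall>i p. p < \<infinity> \<longrightarrow>
      (\<forall>a\<in>{0..1}. a * (v i - enn2real p) \<le> accept (B i) h p * (v i - enn2real p)))"
    using sequential unfolding sequentially_rational_def by (elim conjE)
  moreover have "p < \<infinity>" using assms(3) by (simp add: less_top)
  ultimately show ?thesis using assms(1,2,4) by blast
qed

lemma accept_below_value:
  assumes "h \<in> histories M R" "length h = R" "p \<noteq> \<top>" "enn2real p < v i"
  shows "accept (B i) h p = 1"
proof -
  have "1 * (v i - enn2real p) \<le> accept (B i) h p * (v i - enn2real p)"
    using assms by (intro accept_optimal) auto
  then have "1 \<le> accept (B i) h p" using assms(4) by simp
  with accept_bounds(2)[OF assms(1,2)] show ?thesis by (simp add: antisym)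
qed

lemma accept_above_value:
  assumes "h \<in> histories M R" "length h = R" "v i < enn2real p"
  shows "accept (B i) h p = 0"
proof -
  have "p \<noteq> \<top>" using assms(3) v_nonneg[of i] by auto
  then have "0 * (v i - enn2real p) \<le> accept (B i) h p * (v i - enn2real p)"
    using assms by (intro accept_optimal) auto
  then have "accept (B i) h p \<le> 0" using assms(3) by (simp add: zero_le_mult_iff)
  with accept_bounds(1)[OF assms(1,2)] show ?thesis by (simp add: antisym)
qed

text \<open>Sequential rationality leaves acceptance open at a price equal to the value, where the
  surplus is 0 anyway. The case \<open>\<top>\<close> is separate because
  \<open>enn2real \<top> = 0\<close> would make refusal look like a gift.\<close>

lemma accept_times_surplus:
  assumes "h \<in> histories M R" "length h = R"
  shows "accept (B i) h p * (v i - enn2real p) =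
    (if p = \<top> then 0 else max 0 (v i - enn2real p))"
  using accept_below_value[OF assms, where p = p and i = i]
    accept_above_value[OF assms, where p = p and i = i] accept_bounds(3)[OF assms, of i]
  by (cases "enn2real p" "v i" rule: linorder_cases) auto

text \<open>Unlike \<open>profit\<close>, this uses the actual acceptance, which may reject a price
  equal to the value.\<close>

definition posting_profit :: "'s \<Rightarrow> nat list \<Rightarrow> ennreal \<Rightarrow> real" where
  "posting_profit k h p = (\<Sum>i\<in>UNIV. pmf (q h) i * (accept (B i) h p * (enn2real p - c k)))"

lemma posting_profit_measurable:
  assumes "h \<in> histories M R" "length h = R"
  shows "posting_profit k h \<in> borel_measurable borel"
  unfolding posting_profit_def[abs_def]
  using accept_measurable[OF assms] by measurable

text \<open>Prices above \<open>v i\<close> are rejected, so the integrand is bounded and integrable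
  under every price distribution.\<close>

lemma accept_times_margin_bound:
  assumes "h \<in> histories M R" "length h = R"
  shows "\<bar>accept (B i) h p * (enn2real p - c k)\<bar> \<le> v i + c k"
proof (cases "enn2real p \<le> v i")
  case True
  have "\<bar>accept (B i) h p * (enn2real p - c k)\<bar> \<le> 1 * \<bar>enn2real p - c k\<bar>"
    unfolding abs_mult using accept_bounds(1,2)[OF assms, of i p] by (intro mult_right_mono) auto
  also have "\<dots> \<le> v i + c k" using True c_nonneg[of k] enn2real_nonneg[of p]
    unfolding mult_1 abs_le_iff by (intro conjI) linarith+
  finally show ?thesis .
next
  case False
  then show ?thesis using accept_above_value[OF assms, where p = p and i = i] v_nonneg[of i] c_nonneg[of k] by simp
qed

lemma posting_profit_integral:
  assumes h: "h \<in> histories M R" "length h = R"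
    and N: "prob_space N" "sets N = sets borel"
  shows "integrable N (posting_profit k h)"
    and "(\<integral>p. posting_profit k h p \<partial>N) =
      (\<Sum>i\<in>UNIV. pmf (q h) i * (\<integral>p. accept (B i) h p * (enn2real p - c k) \<partial>N))"
proof -
  interpret prob_space N by fact
  have [measurable_cong]: "sets N = sets borel" by fact
  have [measurable]: "accept (B i) h \<in> borel_measurable borel" for i by (rule accept_measurable[OF h])
  have int: "integrable N (\<lambda>p. accept (B i) h p * (enn2real p - c k))" for i
    by (rule integrable_const_bound[where B = "v i + c k"])
       (use accept_times_margin_bound[OF h] in auto)
  then show "integrable N (posting_profit k h)"
    unfolding posting_profit_def[abs_def] by (intro Bochner_Integration.integrable_sum) auto
  show "(\<integral>p. posting_profit k h p \<partial>N) =
      (\<Sum>i\<in>UNIV. pmf (q h) i * (\<integral>p. accept (B i) h p * (enn2real p - c k) \<partial>N))"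
    unfolding posting_profit_def using int by (subst Bochner_Integration.integral_sum) auto
qed

lemma seller_value_terminal:
  assumes h: "h \<in> histories M R" "length h = R" and s: "is_seller_strategy M R s"
  shows "seller_value R (c k) (q h) B s h = (\<integral>p. posting_profit k h p \<partial>post s h)"
  using h s posting_profit_integral(2)[OF h, of "post s h" k]
  by (simp add: seller_value_def seller_cont_payoff_def expectation_finite_type is_seller_strategy_def)

text \<open>Letting indifferent buyers accept helps the seller as long as the margin is
  nonnegative.\<close>

lemma posting_profit_le_profit:
  assumes h: "h \<in> histories M R" "length h = R" and p: "c k \<le> enn2real p"
  shows "posting_profit k h p \<le> profit v (q h) (c k) (enn2real p)"
proof -
  have "posting_profit k h p \<le>
      (\<Sum>i\<in>UNIV. if enn2real p \<le> v i then (enn2real p - c k) * pmf (q h) i else 0)"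
    unfolding posting_profit_def
  proof (rule sum_mono)
    fix i
    show "pmf (q h) i * (accept (B i) h p * (enn2real p - c k)) \<le>
        (if enn2real p \<le> v i then (enn2real p - c k) * pmf (q h) i else 0)"
    proof (cases "enn2real p \<le> v i")
      case True
      have "accept (B i) h p * (pmf (q h) i * (enn2real p - c k)) \<le> 1 * (pmf (q h) i * (enn2real p - c k))"
        using accept_bounds[OF h] p by (intro mult_right_mono) auto
      with True show ?thesis by (simp add: algebra_simps)
    next
      case False
      then show ?thesis using accept_above_value[OF h] by simp
    qed
  qed
  also have "\<dots> = profit v (q h) (c k) (enn2real p)"
    by (simp add: profit_def demand_def sum_distrib_left sum.If_cases)
  finally show ?thesis .
qed

lemma posting_profit_le_monopoly_profit:
  assumes h: "h \<in> histories M R" "length h = R"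
  shows "posting_profit k h p \<le> monopoly_profit v (q h) (c k)"
proof (cases "c k \<le> enn2real p")
  case True
  then show ?thesis
    using posting_profit_le_profit[OF h] profit_le_monopoly_profit order_trans by blast
next
  case False
  then have "posting_profit k h p \<le> 0"
    unfolding posting_profit_def using accept_bounds[OF h]
    by (intro sum_nonpos mult_nonneg_nonpos) auto
  then show ?thesis using monopoly_profit_nonneg order_trans by blast
qed

text \<open>The seller may deviate to the sure price \<open>p\<close>.\<close>

lemma posting_profit_le_value:
  assumes h: "h \<in> histories M R" "length h = R"
  shows "posting_profit k h p \<le> seller_eq_value k h"
proof -
  define s where "s = (S k)\<lparr>post := \<lambda>_. return borel p\<rparr>"
  have s: "is_seller_strategy M R s"
    using strategies(2)[of k] by (auto simp: s_def is_seller_strategy_def prob_space_return)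
  have "posting_profit k h p = (\<integral>p. posting_profit k h p \<partial>post s h)"
    using posting_profit_measurable[OF h] by (simp add: s_def integral_return)
  also have "\<dots> = seller_value R (c k) (q h) B s h" by (rule seller_value_terminal[OF h s, symmetric])
  also have "\<dots> \<le> seller_eq_value k h"
    using sequential h(1) s by (simp add: sequentially_rational_def seller_eq_value_def)
  finally show ?thesis .
qed

text \<open>
  Buyers may refuse a price equal to their value, so the monopoly profit is only approached by
  prices slightly below a value.
\<close>

lemma monopoly_profit_le_value:
  assumes h: "h \<in> histories M R" "length h = R"
  shows "monopoly_profit v (q h) (c k) \<le> seller_eq_value k h"
proof -
  let ?W = "seller_eq_value k h"
  \<comment> \<open>Posting \<open>\<top>\<close> secures 0.\<close>
  have W: "0 \<le> ?W"
    using posting_profit_le_value[OF h, of k \<top>] accept_bounds(3)[OF h] by (simp add: posting_profit_def)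
  have "profit v (q h) (c k) (v j) \<le> ?W" for j
  proof (rule ccontr)
    let ?D = "demand v (q h) (v j)"
    assume "\<not> profit v (q h) (c k) (v j) \<le> ?W"
    then have less: "?W < (v j - c k) * ?D" by (simp add: profit_def)
    with W have "0 < (v j - c k) * ?D" by simp
    from profit_posD[of v "q h" "c k" "v j"] this have D: "c k < v j" "0 < ?D"
      by (auto simp: profit_def)
    have "?W / ?D < v j - c k" using less D(2) by (simp add: pos_divide_less_eq)
    \<comment> \<open>\<open>r\<close> undercuts \<open>v j\<close>, so every type with value at
      least \<open>v j\<close> strictly prefers to buy, yet it is close enough to \<open>v j\<close>
      to earn more than \<open>?W\<close>.\<close>
    then obtain r where r: "?W / ?D < r - c k" "r < v j"
      using dense[of "c k + ?W / ?D" "v j"] by (auto simp: algebra_simps)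
    have "0 \<le> ?W / ?D" using W D(2) by simp
    with r(1) have "c k < r" by linarith
    then have "0 \<le> r" using c_nonneg[of k] by linarith
    have "?W < (r - c k) * ?D" using r(1) D(2) by (simp add: pos_divide_less_eq)
    also have "\<dots> = (\<Sum>i\<in>UNIV. if v j \<le> v i then pmf (q h) i * (r - c k) else 0)"
      by (simp add: demand_def sum_distrib_left sum.If_cases mult.commute)
    also have "\<dots> \<le> posting_profit k h (ennreal r)"
      unfolding posting_profit_def
    proof (rule sum_mono)
      fix i
      have "accept (B i) h (ennreal r) = 1" if "v j \<le> v i"
        using that r(2) \<open>0 \<le> r\<close> by (intro accept_below_value[OF h]) auto
      then show "(if v j \<le> v i then pmf (q h) i * (r - c k) else 0) \<le>
          pmf (q h) i * (accept (B i) h (ennreal r) * (enn2real (ennreal r) - c k))"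
        using \<open>0 \<le> r\<close> \<open>c k < r\<close> accept_bounds(1)[OF h] by auto
    qed
    also have "\<dots> \<le> ?W" by (rule posting_profit_le_value[OF h])
    finally show False by simp
  qed
  then show ?thesis using W unfolding monopoly_profit_def by (subst Max_le_iff) auto
qed

text \<open>The value is the mean of \<open>posting_profit\<close>. It reaches the monopoly profit,
  a pointwise upper bound, so the bound is attained almost surely.\<close>

lemma terminal_posting:
  assumes h: "h \<in> histories M R" "length h = R"
  shows "seller_eq_value k h = monopoly_profit v (q h) (c k)"
    and "AE p in post (S k) h. posting_profit k h p = monopoly_profit v (q h) (c k)"
proof -
  let ?N = "post (S k) h"
  have N: "prob_space ?N" "sets ?N = sets borel"
    using strategies(2)[of k] h by (auto simp: is_seller_strategy_def)
  interpret prob_space ?N by (rule N)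
  note int = posting_profit_integral(1)[OF h N, of k]
  have W: "seller_eq_value k h = (\<integral>p. posting_profit k h p \<partial>?N)"
    unfolding seller_eq_value_def by (rule seller_value_terminal[OF h strategies(2)])
  have "\<dots> \<le> monopoly_profit v (q h) (c k)"
    using int posting_profit_le_monopoly_profit[OF h] by (intro integral_le_const) auto
  with W monopoly_profit_le_value[OF h, of k]
  show val: "seller_eq_value k h = monopoly_profit v (q h) (c k)" by simp
  have "(\<integral>p. monopoly_profit v (q h) (c k) - posting_profit k h p \<partial>?N) = 0"
    using int W val by (subst Bochner_Integration.integral_diff) (auto simp: prob_space)
  then have "AE p in ?N. monopoly_profit v (q h) (c k) - posting_profit k h p = 0"
    using int posting_profit_le_monopoly_profit[OF h]
    by (subst (asm) integral_nonneg_eq_0_iff_AE) auto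
  then show "AE p in ?N. posting_profit k h p = monopoly_profit v (q h) (c k)"
    by eventually_elim simp
qed

text \<open>With a profitable sale, almost all posted prices are monopoly prices and
  \<open>g\<close> collects their point masses. Without one, \<open>g\<close> is zero, because
  supported buyers could gain only from sales at a loss.\<close>

lemma terminal_prices:
  assumes h: "h \<in> histories M R" "length h = R"
  shows "\<exists>g. posts_optimally v (q h) (c k) g \<and>
    (\<forall>i. hinge_sum (range v) g (v i) \<le>
      (\<integral>p. accept (B i) h p * (v i - enn2real p) \<partial>post (S k) h)) \<and>
    (\<forall>i\<in>set_pmf (q h). hinge_sum (range v) g (v i) =
      (\<integral>p. accept (B i) h p * (v i - enn2real p) \<partial>post (S k) h))"
proof (cases "\<exists>i\<in>set_pmf (q h). c k < v i")
  case True
  let ?N = "post (S k) h" and ?mono = "monopoly_price v (q h) (c k)"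
  have N: "prob_space ?N" "sets ?N = sets borel"
    using strategies(2)[of k] h by (auto simp: is_seller_strategy_def)
  define F where "F = {r\<in>range v. ?mono r}"
  have F: "finite F" "F \<subseteq> range v" "inj_on ennreal F"
    using v_nonneg by (auto simp: F_def intro!: inj_onI)
  define g where "g r = (if ?mono r then measure ?N {ennreal r} else 0)" for r
  have pos: "0 < monopoly_profit v (q h) (c k)" using True by (simp add: monopoly_profit_pos_iff)
  \<comment> \<open>Earning the positive monopoly profit forces a finite price above cost that
    attains the maximum of \<open>profit\<close>, hence a monopoly price.\<close>
  have supp: "AE p in ?N. p \<in> ennreal ` F"
    using terminal_posting(2)[OF h]
  proof eventually_elim
    case (elim p)
    then have pp: "0 < posting_profit k h p" using pos by simp
    then have "p \<noteq> \<top>" using accept_bounds(3)[OF h] by (auto simp: posting_profit_def)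
    have "\<not> enn2real p \<le> c k"
    proof
      assume "enn2real p \<le> c k"
      then have "posting_profit k h p \<le> 0"
        unfolding posting_profit_def using accept_bounds[OF h]
        by (intro sum_nonpos mult_nonneg_nonpos) auto
      with pp show False by simp
    qed
    then have "monopoly_profit v (q h) (c k) \<le> profit v (q h) (c k) (enn2real p)"
      using posting_profit_le_profit[OF h, of k p] elim by simp
    then have "?mono (enn2real p)"
      using profit_le_monopoly_profit pos by (intro monopoly_priceI antisym)
    moreover from this have "enn2real p \<in> range v" by (auto simp: monopoly_price_def)
    moreover have "p = ennreal (enn2real p)" using \<open>p \<noteq> \<top>\<close> by (simp add: less_top)
    ultimately show ?case unfolding F_def by blast
  qed
  have integral: "(\<integral>p. f p \<partial>?N) = (\<Sum>r\<in>range v. g r * f (ennreal r))"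
    if "f \<in> borel_measurable borel" for f :: "ennreal \<Rightarrow> real"
  proof -
    have "(\<integral>p. f p \<partial>?N) = (\<Sum>p\<in>ennreal ` F. measure ?N {p} * f p)"
      using F(1) that by (intro integral_finite_support[OF N _ supp]) auto
    also have "\<dots> = (\<Sum>r\<in>F. g r * f (ennreal r))"
      by (subst sum.reindex[OF F(3)]) (simp add: g_def F_def)
    also have "\<dots> = (\<Sum>r\<in>range v. g r * f (ennreal r))"
      by (rule sum.mono_neutral_left) (auto simp: F_def g_def)
    finally show ?thesis .
  qed
  have "sum g (range v) = 1"
    using integral[of "\<lambda>_. 1"] N(1) by (simp add: prob_space.prob_space)
  then have "posts_optimally v (q h) (c k) g"
    using True by (auto simp: posts_optimally_def g_def split: if_splits)
  moreover have "(\<integral>p. accept (B i) h p * (v i - enn2real p) \<partial>?N) = hinge_sum (range v) g (v i)" for i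
  proof -
    have "(\<lambda>p. accept (B i) h p * (v i - enn2real p)) \<in> borel_measurable borel"
      using accept_measurable[OF h] by measurable
    from integral[OF this] show ?thesis
      unfolding accept_times_surplus[OF h] hinge_sum_def using v_nonneg by (auto intro!: sum.cong)
  qed
  ultimately show ?thesis by (intro exI[of _ g]) simp
next
  case False
  let ?N = "post (S k) h"
  have mp0: "monopoly_profit v (q h) (c k) = 0"
    using False monopoly_profit_nonneg[of v "q h" "c k"] by (simp add: monopoly_profit_pos_iff[symmetric])
  have hinge0: "hinge_sum (range v) (\<lambda>_. 0) x = 0" for x by (simp add: hinge_sum_def)
  show ?thesis
  proof (intro exI[of _ "\<lambda>_. 0"] conjI allI ballI)
    show "posts_optimally v (q h) (c k) (\<lambda>_. 0)" using False by (auto simp: posts_optimally_def)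
    show "hinge_sum (range v) (\<lambda>_. 0) (v i) \<le> (\<integral>p. accept (B i) h p * (v i - enn2real p) \<partial>?N)" for i
      unfolding hinge0 accept_times_surplus[OF h] by (intro Bochner_Integration.integral_nonneg) simp
    fix i assume i: "i \<in> set_pmf (q h)"
    have "AE p in ?N. accept (B i) h p * (v i - enn2real p) = 0"
      using terminal_posting(2)[OF h, of k]
    proof eventually_elim
      case (elim p)
      show ?case
      proof (rule ccontr)
        assume "accept (B i) h p * (v i - enn2real p) \<noteq> 0"
        then have p: "p \<noteq> \<top>" "enn2real p < v i"
          unfolding accept_times_surplus[OF h] by (auto split: if_splits simp: max_def)
        \<comment> \<open>All supported values are at most \<open>c k\<close>, so a price that gives
          \<open>i\<close> a positive surplus lies below cost, and his acceptance makes the profit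
          negative.\<close>
        have "enn2real p < c k" using p(2) False i by force
        have "0 < (\<Sum>j\<in>UNIV. pmf (q h) j * (accept (B j) h p * (c k - enn2real p)))"
        proof (rule sum_pos2[of _ i])
          show "0 < pmf (q h) i * (accept (B i) h p * (c k - enn2real p))"
            using accept_below_value[OF h p] i \<open>enn2real p < c k\<close> by (simp add: pmf_positive_iff)
          show "0 \<le> pmf (q h) j * (accept (B j) h p * (c k - enn2real p))" for j
            using accept_bounds[OF h] \<open>enn2real p < c k\<close> by simp
        qed auto
        also have "\<dots> = - posting_profit k h p"
          by (simp add: posting_profit_def sum_negf[symmetric] algebra_simps)
        finally show False using elim mp0 by simp
      qed
    qed
    then have "(\<integral>p. accept (B i) h p * (v i - enn2real p) \<partial>?N) = 0"
      by (rule integral_eq_zero_AE)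
    then show "hinge_sum (range v) (\<lambda>_. 0) (v i) = (\<integral>p. accept (B i) h p * (v i - enn2real p) \<partial>?N)"
      by (simp add: hinge0)
  qed
qed

lemma pooled_terminal:
  assumes h: "h \<in> histories M R" "length h = R"
  shows "\<exists>g. pooled h g"
proof -
  define I where "I i k = (\<integral>p. accept (B i) h p * (v i - enn2real p) \<partial>post (S k) h)" for i k
  have "\<forall>k. \<exists>g. posts_optimally v (q h) (c k) g \<and> (\<forall>i. hinge_sum (range v) g (v i) \<le> I i k) \<and>
      (\<forall>i\<in>set_pmf (q h). hinge_sum (range v) g (v i) = I i k)"
    unfolding I_def using terminal_prices[OF h] by (rule allI)
  from choice[OF this] obtain g where g: "\<And>k. posts_optimally v (q h) (c k) (g k)"
    "\<And>k i. hinge_sum (range v) (g k) (v i) \<le> I i k"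
    "\<And>k i. i \<in> set_pmf (q h) \<Longrightarrow> hinge_sum (range v) (g k) (v i) = I i k"
    by blast
  have val: "buyer_eq_value i h = (\<Sum>k\<in>UNIV. pmf (\<rho> h) k * I i k)" for i
    using h(2) by (simp add: buyer_eq_value_def buyer_value_def buyer_cont_payoff_def
        expectation_finite_type I_def)
  have "surplus v (\<rho> h) g (v i) \<le> buyer_eq_value i h" for i
    unfolding surplus_def hinge_sum_mixture val using g(2) by (intro sum_mono mult_left_mono) auto
  moreover have "surplus v (\<rho> h) g (v i) = buyer_eq_value i h" if "i \<in> set_pmf (q h)" for i
    unfolding surplus_def hinge_sum_mixture val using g(3) that by simp
  ultimately have "pooled h g" using g(1) terminal_posting(1)[OF h] by (auto simp: pooled_def)
  then show ?thesis by blast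
qed

lemma ex_pooled:
  assumes "h \<in> histories M R"
  shows "\<exists>g. pooled h g"
  using assms
proof (induction "R - length h" arbitrary: h)
  case 0
  then show ?case by (intro pooled_terminal) (auto simp: histories_def)
next
  case (Suc r)
  then have len: "length h < R" by simp
  have IH: "\<exists>g. pooled (h @ [m]) g" if "m \<in> {1..M}" for m
    using Suc.hyps len by (intro Suc.hyps(1) histories_append[OF Suc.prems len that]) simp
  show ?case
  proof (cases "even (R - length h)")
    case True
    then have "seller_turn R h" unfolding seller_turn_def using len by blast
    then show ?thesis using pooled_seller_turn[OF Suc.prems] IH by blast
  next
    case False
    then have "buyer_turn R h" unfolding buyer_turn_def using len by blast
    then show ?thesis using pooled_buyer_turn[OF Suc.prems] IH by blast
  qed
qed

end

subsection \<open>Babbling equilibria\<close>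

definition net_surplus :: "real \<Rightarrow> ennreal \<Rightarrow> real" where
  "net_surplus x p = (if p = \<top> then 0 else max 0 (x - enn2real p))"

definition posted_profit :: "('b::finite \<Rightarrow> real) \<Rightarrow> 'b pmf \<Rightarrow> real \<Rightarrow> ennreal \<Rightarrow> real" where
  "posted_profit v q c p = (if p = \<top> then 0 else profit v q c (enn2real p))"

text \<open>This turns the weights \<open>g\<close> into a genuine price lottery with the same
  surplus for every value; the zero function becomes the sure price \<open>\<top>\<close>.\<close>

lemma ex_price_pmf:
  assumes g: "posts_optimally v q c g" and v: "\<And>i. 0 \<le> v i"
  shows "\<exists>D. finite (set_pmf D) \<and>
    (\<forall>p\<in>set_pmf D. posted_profit v q c p = monopoly_profit v q c) \<and>
    (\<forall>x. measure_pmf.expectation D (net_surplus x) = hinge_sum (range v) g x)"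
proof (cases "\<exists>i\<in>set_pmf q. c < v i")
  case True
  note g' = posts_optimallyD[OF g]
  have V: "p \<in> range v" if "g p \<noteq> 0" for p using g'(2)[OF that] by (auto simp: monopoly_price_def)
  have V0: "g p = 0" if "p \<notin> range v" for p using V that by blast
  have "(\<integral>\<^sup>+ x. ennreal (g x) \<partial>count_space UNIV) = (\<Sum>x\<in>range v. ennreal (g x))"
    by (rule nn_integral_count_space') (simp_all add: V0)
  also have "\<dots> = ennreal (sum g (range v))" using g'(1) by (intro sum_ennreal) auto
  also have "\<dots> = 1" using True g'(4) by auto
  finally have int1: "(\<integral>\<^sup>+ x. ennreal (g x) \<partial>count_space UNIV) = 1" .
  define G where "G = embed_pmf g"
  have G: "pmf G x = g x" for x unfolding G_def using g'(1) int1 by (intro pmf_embed_pmf)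
  have supp: "set_pmf G \<subseteq> range v" using V by (auto simp: set_pmf_iff G)
  have "finite (set_pmf (map_pmf ennreal G))" using finite_subset[OF supp] by simp
  moreover have "posted_profit v q c p = monopoly_profit v q c" if p: "p \<in> set_pmf (map_pmf ennreal G)" for p
  proof -
    obtain r where "p = ennreal r" "r \<in> set_pmf G" using p by auto
    then have r: "p = ennreal r" "g r \<noteq> 0" by (auto simp: set_pmf_iff G)
    then have "0 \<le> r" using V v by auto
    then show ?thesis using r(1) g'(2)[OF r(2)] by (simp add: posted_profit_def monopoly_price_def)
  qed
  moreover have "measure_pmf.expectation (map_pmf ennreal G) (net_surplus x) = hinge_sum (range v) g x" for x
  proof -
    have "measure_pmf.expectation (map_pmf ennreal G) (net_surplus x) =
        (\<Sum>r\<in>range v. net_surplus x (ennreal r) * pmf G r)"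
      unfolding integral_map_pmf using supp by (intro integral_measure_pmf_real) auto
    also have "\<dots> = hinge_sum (range v) g x"
      unfolding hinge_sum_def using v by (intro sum.cong) (auto simp: G net_surplus_def)
    finally show ?thesis .
  qed
  ultimately show ?thesis by blast
next
  case False
  then have "monopoly_profit v q c = 0"
    using monopoly_profit_nonneg[of v q c] by (simp add: monopoly_profit_pos_iff[symmetric])
  moreover have "g p = 0" for p using g False by (simp add: posts_optimally_def)
  ultimately show ?thesis
    by (intro exI[of _ "return_pmf \<top>"]) (simp add: posted_profit_def net_surplus_def hinge_sum_def)
qed

text \<open>Indifferent buyers accept, so a monopoly price earns exactly the monopoly profit. The
  \<open>distr\<close> moves the discrete measure to the Borel sets that strategies require.\<close>

definition babbling ::
  "('b::finite \<Rightarrow> real) \<Rightarrow> 'b pmf \<Rightarrow> 's pmf \<Rightarrow> ('s \<Rightarrow> ennreal pmf) \<Rightarrow> ('b, 's) assessment" where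
  "babbling v \<mu> \<nu> D =
    \<lparr>buyer_strat = \<lambda>i. \<lparr>buyer_msg = \<lambda>_. return_pmf 1,
       accept = \<lambda>_ p. if p \<le> ennreal (v i) then 1 else 0\<rparr>,
     seller_strat = \<lambda>k. \<lparr>seller_msg = \<lambda>_. return_pmf 1,
       post = \<lambda>_. distr (measure_pmf (D k)) borel (\<lambda>p. p)\<rparr>,
     buyer_belief = \<lambda>_. \<nu>,
     seller_belief = \<lambda>_. \<mu>\<rparr>"

lemma all_messages_uninformative_babbling: "all_messages_uninformative M R (babbling v \<mu> \<nu> D)"
  by (simp add: all_messages_uninformative_def uninformative_def babbling_def)

text \<open>A message that all types send with the same probability carries no information.\<close>

lemma bayes_update_const:
  fixes q :: "'t::finite pmf"
  shows "bayes_update q (\<lambda>_. a) q"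
  using sum_pmf_finite_type[of q] by (simp add: bayes_update_def sum_distrib_right[symmetric])

lemma expectation_talk_le:
  fixes F :: "nat list \<Rightarrow> real"
  assumes "is_buyer_strategy M R b" "is_seller_strategy M R s" "h \<in> histories M R"
    and "\<And>h'. h' \<in> histories M R \<Longrightarrow> length h' = R \<Longrightarrow> F h' \<le> C"
  shows "measure_pmf.expectation (talk (R - length h) b s h) F \<le> C"
proof (rule measure_pmf.integral_le_const)
  show "integrable (talk (R - length h) b s h) F"
    using finite_set_pmf_talk[OF assms(1-3)] by (rule integrable_measure_pmf_finite)
  show "AE h' in talk (R - length h) b s h. F h' \<le> C"
    using set_pmf_talk[OF assms(1-3)] assms(4) by (auto simp: AE_measure_pmf_iff)
qed

lemma expectation_talk_eq:
  fixes F :: "nat list \<Rightarrow> real"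
  assumes "is_buyer_strategy M R b" "is_seller_strategy M R s" "h \<in> histories M R"
    and "\<And>h'. h' \<in> histories M R \<Longrightarrow> length h' = R \<Longrightarrow> F h' = C"
  shows "measure_pmf.expectation (talk (R - length h) b s h) F = C"
proof -
  have "measure_pmf.expectation (talk (R - length h) b s h) F =
      measure_pmf.expectation (talk (R - length h) b s h) (\<lambda>_. C)"
    using set_pmf_talk[OF assms(1-3)] assms(4)
    by (intro integral_cong_AE) (auto simp: AE_measure_pmf_iff)
  then show ?thesis by simp
qed

section \<open>Babbling with optimal prices is an equilibrium\<close>

locale babbling_game =
  fixes M R :: nat
    and v :: "'b::finite \<Rightarrow> real" and c :: "'s::finite \<Rightarrow> real"
    and \<mu> :: "'b pmf" and \<nu> :: "'s pmf" and D :: "'s \<Rightarrow> ennreal pmf"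
  assumes M: "1 \<le> M" and v_nonneg: "0 \<le> v i" and c_nonneg: "0 \<le> c k"
    and finite_prices: "finite (set_pmf (D k))"
    and optimal_prices: "p \<in> set_pmf (D k) \<Longrightarrow> posted_profit v \<mu> (c k) p = monopoly_profit v \<mu> (c k)"
begin

abbreviation "E \<equiv> babbling v \<mu> \<nu> D"

lemma strategies: "is_buyer_strategy M R (buyer_strat E i)" "is_seller_strategy M R (seller_strat E k)"
  using M by (auto simp: babbling_def is_buyer_strategy_def is_seller_strategy_def top_unique
      measure_pmf.prob_space_distr)

lemma post_integral:
  fixes f :: "ennreal \<Rightarrow> real"
  assumes "f \<in> borel_measurable borel"
  shows "(\<integral>p. f p \<partial>post (seller_strat E k) h) = measure_pmf.expectation (D k) f"
  using assms by (simp add: babbling_def integral_distr)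

lemma accept_measurable: "accept (buyer_strat E i) h \<in> borel_measurable borel"
  by (simp add: babbling_def)

lemma accept_simps:
  "accept (buyer_strat E i) h \<top> = 0"
  "p \<noteq> \<top> \<Longrightarrow> accept (buyer_strat E i) h p = (if enn2real p \<le> v i then 1 else 0)"
  using v_nonneg[of i] by (cases p; simp add: babbling_def top_unique)+

lemma accept_optimal:
  assumes "p \<noteq> \<top>" "a \<in> {0..1}"
  shows "a * (x - enn2real p) \<le> net_surplus x p"
  using assms mult_right_mono[of a 1 "x - enn2real p"] mult_nonneg_nonpos[of a "x - enn2real p"]
  by (cases "enn2real p \<le> x") (auto simp: net_surplus_def)

lemma accept_times_surplus:
  "accept (buyer_strat E i) h p * (v i - enn2real p) = net_surplus (v i) p"
  by (cases "p = \<top>") (auto simp: accept_simps net_surplus_def)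

lemma buyer_cont_payoff_eq:
  assumes "h \<in> histories M R"
  shows "buyer_cont_payoff R (v i) (buyer_strat E i) (seller_strat E k) h =
    measure_pmf.expectation (D k) (net_surplus (v i))"
  unfolding buyer_cont_payoff_def
proof (rule expectation_talk_eq[OF strategies assms])
  fix h'
  show "(\<integral>p. accept (buyer_strat E i) h' p * (v i - enn2real p) \<partial>post (seller_strat E k) h') =
      measure_pmf.expectation (D k) (net_surplus (v i))"
  proof -
    have [measurable]: "accept (buyer_strat E i) h' \<in> borel_measurable borel" by (rule accept_measurable)
    have "(\<lambda>p. accept (buyer_strat E i) h' p * (v i - enn2real p)) \<in> borel_measurable borel"
      by measurable
    from post_integral[OF this] show ?thesis by (simp only: accept_times_surplus)
  qed
qed

text \<open>The price lottery ignores the talk, and \<open>net_surplus\<close> bounds every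
  acceptance rule price by price.\<close>

lemma buyer_cont_payoff_le:
  assumes h: "h \<in> histories M R" and b: "is_buyer_strategy M R b"
  shows "buyer_cont_payoff R x b (seller_strat E k) h \<le> measure_pmf.expectation (D k) (net_surplus x)"
  unfolding buyer_cont_payoff_def
proof (rule expectation_talk_le[OF b strategies(2) h])
  fix h' assume h': "h' \<in> histories M R" "length h' = R"
  have [measurable]: "accept b h' \<in> borel_measurable borel" and
    acc: "0 \<le> accept b h' p" "accept b h' p \<le> 1" "accept b h' \<top> = 0" for p
    using b h' by (auto simp: is_buyer_strategy_def)
  have le: "accept b h' p * (x - enn2real p) \<le> net_surplus x p" for p
    using accept_optimal[of p "accept b h' p" x] acc
    by (cases "p = \<top>") (auto simp: net_surplus_def)
  have "(\<integral>p. accept b h' p * (x - enn2real p) \<partial>post (seller_strat E k) h') =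
      measure_pmf.expectation (D k) (\<lambda>p. accept b h' p * (x - enn2real p))"
    by (rule post_integral) measurable
  also have "\<dots> \<le> measure_pmf.expectation (D k) (net_surplus x)"
    \<comment> \<open>With finitely many prices every deviation is integrable, so the default value
      of the integral cannot interfere.\<close>
    using le by (intro integral_mono integrable_measure_pmf_finite finite_prices)
  finally show "(\<integral>p. accept b h' p * (x - enn2real p) \<partial>post (seller_strat E k) h') \<le>
      measure_pmf.expectation (D k) (net_surplus x)" .
qed

text \<open>Since ties are resolved by buying, the acceptance of all types adds up to
  \<open>demand\<close>.\<close>

lemma sum_accept_times_margin:
  "(\<Sum>i\<in>UNIV. pmf \<mu> i * (accept (buyer_strat E i) h p * (enn2real p - y))) = posted_profit v \<mu> y p"
proof (cases "p = \<top>")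
  case True
  then show ?thesis by (simp add: accept_simps posted_profit_def)
next
  case False
  have "(\<Sum>i\<in>UNIV. pmf \<mu> i * (accept (buyer_strat E i) h p * (enn2real p - y))) =
      (\<Sum>i\<in>UNIV. if enn2real p \<le> v i then (enn2real p - y) * pmf \<mu> i else 0)"
    using False by (intro sum.cong) (auto simp: accept_simps)
  then show ?thesis
    using False by (simp add: posted_profit_def profit_def demand_def sum_distrib_left sum.If_cases)
qed

lemma integrable_margin:
  assumes N: "prob_space N" "sets N = sets borel" and "0 \<le> y"
  shows "integrable N (\<lambda>p. accept (buyer_strat E i) h p * (enn2real p - y))"
proof -
  interpret prob_space N by fact
  have [measurable_cong]: "sets N = sets borel" by fact
  have [measurable]: "accept (buyer_strat E i) h \<in> borel_measurable borel" by (rule accept_measurable)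
  have "\<bar>accept (buyer_strat E i) h p * (enn2real p - y)\<bar> \<le> v i + y" for p
  proof (cases "p = \<top> \<or> v i < enn2real p")
    case True
    then show ?thesis using v_nonneg[of i] \<open>0 \<le> y\<close> by (cases "p = \<top>") (auto simp: accept_simps)
  next
    case False
    have "0 \<le> enn2real p" by simp
    with False v_nonneg[of i] \<open>0 \<le> y\<close> have "\<bar>enn2real p - y\<bar> \<le> v i + y"
      unfolding abs_le_iff by (intro conjI) linarith+
    with False show ?thesis by (simp add: accept_simps)
  qed
  then show ?thesis by (intro integrable_const_bound[where B = "v i + y"]) auto
qed

text \<open>All buyer types send the same messages, so the talk of an arbitrary representative
  \<open>i\<close> serves for all of them and the average over types moves inside.\<close>

lemma seller_value_eq:
  assumes h: "h \<in> histories M R" and s: "is_seller_strategy M R s" and "0 \<le> y"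
  shows "seller_value R y \<mu> (buyer_strat E) s h =
    measure_pmf.expectation (talk (R - length h) (buyer_strat E i) s h)
      (\<lambda>h'. \<integral>p. posted_profit v \<mu> y p \<partial>post s h')"
proof -
  let ?T = "talk (R - length h) (buyer_strat E i) s h"
  let ?J = "\<lambda>j h'. \<integral>p. accept (buyer_strat E j) h' p * (enn2real p - y) \<partial>post s h'"
  note fin = finite_set_pmf_talk[OF strategies(1)[of i] s h]
  have T: "talk (R - length h) (buyer_strat E j) s h = ?T" for j
    by (rule talk_cong) (simp add: babbling_def)
  have "seller_value R y \<mu> (buyer_strat E) s h =
      (\<Sum>j\<in>UNIV. pmf \<mu> j * measure_pmf.expectation ?T (?J j))"
    unfolding seller_value_def seller_cont_payoff_def expectation_finite_type
  proof (rule sum.cong[OF refl])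
    fix j
    show "pmf \<mu> j * measure_pmf.expectation (talk (R - length h) (buyer_strat E j) s h) (?J j) =
        pmf \<mu> j * measure_pmf.expectation ?T (?J j)"
      unfolding T[of j] ..
  qed
  also have "\<dots> = measure_pmf.expectation ?T (\<lambda>h'. \<Sum>j\<in>UNIV. pmf \<mu> j * ?J j h')"
    using integrable_measure_pmf_finite[OF fin] by (subst Bochner_Integration.integral_sum) auto
  also have "\<dots> = measure_pmf.expectation ?T (\<lambda>h'. \<integral>p. posted_profit v \<mu> y p \<partial>post s h')"
  proof (intro integral_cong_AE)
    show "AE h' in ?T. (\<Sum>j\<in>UNIV. pmf \<mu> j * ?J j h') = (\<integral>p. posted_profit v \<mu> y p \<partial>post s h')"
      unfolding AE_measure_pmf_iff
    proof
      fix h' assume "h' \<in> set_pmf ?T"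
      then have "h' \<in> histories M R" "length h' = R" using set_pmf_talk[OF strategies(1) s h] by blast+
      then have N: "prob_space (post s h')" "sets (post s h') = sets borel"
        using s by (auto simp: is_seller_strategy_def)
      show "(\<Sum>j\<in>UNIV. pmf \<mu> j * ?J j h') = (\<integral>p. posted_profit v \<mu> y p \<partial>post s h')"
        unfolding sum_accept_times_margin[of h', symmetric]
        using integrable_margin[OF N \<open>0 \<le> y\<close>] by (subst Bochner_Integration.integral_sum) auto
    qed
  qed auto
  finally show ?thesis .
qed

lemma posted_profit_measurable: "posted_profit v \<mu> y \<in> borel_measurable borel"
proof -
  have [measurable]: "accept (buyer_strat E i) h \<in> borel_measurable borel" for i h
    by (rule accept_measurable)
  \<comment> \<open>Read as a finite combination of acceptance rules, the profit inherits their
    measurability.\<close>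
  show ?thesis unfolding sum_accept_times_margin[of "[]", abs_def, symmetric] by measurable
qed

lemma posted_profit_le: "posted_profit v \<mu> y p \<le> monopoly_profit v \<mu> y"
  by (simp add: posted_profit_def monopoly_profit_nonneg profit_le_monopoly_profit)

lemma seller_value_le:
  assumes h: "h \<in> histories M R" and s: "is_seller_strategy M R s" and y: "0 \<le> y"
  shows "seller_value R y \<mu> (buyer_strat E) s h \<le> monopoly_profit v \<mu> y"
  unfolding seller_value_eq[OF assms, where i = undefined]
proof (rule expectation_talk_le[OF strategies(1) s h])
  fix h' assume "h' \<in> histories M R" "length h' = R"
  then have N: "prob_space (post s h')" "sets (post s h') = sets borel"
    using s by (auto simp: is_seller_strategy_def)
  interpret prob_space "post s h'" by (rule N)
  have "integrable (post s h') (posted_profit v \<mu> y)"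
    unfolding sum_accept_times_margin[of h', abs_def, symmetric]
    using integrable_margin[OF N y] by (intro Bochner_Integration.integrable_sum) auto
  then show "(\<integral>p. posted_profit v \<mu> y p \<partial>post s h') \<le> monopoly_profit v \<mu> y"
    using posted_profit_le by (intro integral_le_const) auto
qed

lemma seller_value_own:
  assumes h: "h \<in> histories M R"
  shows "seller_value R (c k) \<mu> (buyer_strat E) (seller_strat E k) h = monopoly_profit v \<mu> (c k)"
  unfolding seller_value_eq[OF h strategies(2) c_nonneg, where i = undefined]
proof (rule expectation_talk_eq[OF strategies h])
  fix h'
  have "(\<integral>p. posted_profit v \<mu> (c k) p \<partial>post (seller_strat E k) h') =
      measure_pmf.expectation (D k) (\<lambda>_. monopoly_profit v \<mu> (c k))"
    unfolding post_integral[OF posted_profit_measurable] using optimal_prices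
    by (intro integral_cong_AE) (auto simp: AE_measure_pmf_iff)
  then show "(\<integral>p. posted_profit v \<mu> (c k) p \<partial>post (seller_strat E k) h') = monopoly_profit v \<mu> (c k)"
    by simp
qed

lemma buyer_value_own:
  assumes "h \<in> histories M R"
  shows "buyer_value R (v i) \<nu> (buyer_strat E i) (seller_strat E) h =
    (\<Sum>k\<in>UNIV. pmf \<nu> k * measure_pmf.expectation (D k) (net_surplus (v i)))"
  using assms by (simp add: buyer_value_def expectation_finite_type buyer_cont_payoff_eq)

lemma beliefs: "buyer_belief E h = \<nu>" "seller_belief E h = \<mu>"
  by (simp_all add: babbling_def)

lemma babbling_equilibrium: "equilibrium M R v c \<mu> \<nu> E"
proof -
  have "bayes_consistent M R \<mu> \<nu> E"
    by (simp add: bayes_consistent_def babbling_def bayes_update_const)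
  moreover have "sequentially_rational M R v c E"
    unfolding sequentially_rational_def beliefs
  proof (intro conjI ballI allI impI)
    fix h i b assume h: "h \<in> histories M R" and b: "is_buyer_strategy M R b"
    show "buyer_value R (v i) \<nu> b (seller_strat E) h
        \<le> buyer_value R (v i) \<nu> (buyer_strat E i) (seller_strat E) h"
      unfolding buyer_value_own[OF h] unfolding buyer_value_def expectation_finite_type
      using buyer_cont_payoff_le[OF h b] by (intro sum_mono mult_left_mono) auto
  next
    fix h k s assume h: "h \<in> histories M R" and s: "is_seller_strategy M R s"
    show "seller_value R (c k) \<mu> (buyer_strat E) s h
        \<le> seller_value R (c k) \<mu> (buyer_strat E) (seller_strat E k) h"
      unfolding seller_value_own[OF h] using h s c_nonneg by (rule seller_value_le)
  next
    fix h i and p :: ennreal and a :: real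
    assume "p < \<infinity>" "a \<in> {0..1}"
    then show "a * (v i - enn2real p) \<le> accept (buyer_strat E i) h p * (v i - enn2real p)"
      unfolding accept_times_surplus by (intro accept_optimal) auto
  qed
  ultimately show ?thesis using strategies by (simp add: equilibrium_def)
qed

end

section \<open>A payoff-equivalent babbling equilibrium\<close>

theorem theorem5p1:
  fixes M R :: nat
    and v :: "'b::finite \<Rightarrow> real" and c :: "'s::finite \<Rightarrow> real"
    and \<mu> :: "'b pmf" and \<nu> :: "'s pmf"
    and E :: "('b, 's) assessment"
  assumes "M \<ge> 1"
    and "\<And>i. v i \<ge> 0" and "\<And>k. c k \<ge> 0"
    and "set_pmf \<mu> = UNIV" and "set_pmf \<nu> = UNIV"
    and "equilibrium M R v c \<mu> \<nu> E"
  shows "\<exists>E' :: ('b, 's) assessment.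
           equilibrium M R v c \<mu> \<nu> E' \<and>
           interim_payoff_equivalent R v c \<mu> \<nu> E E' \<and>
           all_messages_uninformative M R E'"
proof -
  interpret eq: cheap_talk_equilibrium M R v c \<mu> \<nu> E
    using assms by unfold_locales auto
  have nil: "[] \<in> histories M R" by (simp add: histories_def)
  have prior: "buyer_belief E [] = \<nu>" "seller_belief E [] = \<mu>"
    using eq.bayes by (auto simp: bayes_consistent_def)
  obtain g where g: "eq.pooled [] g" using eq.ex_pooled[OF nil] by blast
  \<comment> \<open>Full support of the priors extends the conclusions of \<open>pooled\<close> at
    the empty history from supported types to all types.\<close>
  have opt: "posts_optimally v \<mu> (c k) (g k)" for k
    using g assms(5) by (simp add: eq.pooled_def prior)
  have seller: "seller_value R (c k) \<mu> (buyer_strat E) (seller_strat E k) [] = monopoly_profit v \<mu> (c k)" for k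
    using g assms(5) by (simp add: eq.pooled_def prior eq.seller_eq_value_def)
  have buyer: "buyer_value R (v i) \<nu> (buyer_strat E i) (seller_strat E) [] = surplus v \<nu> g (v i)" for i
    using g assms(4) by (simp add: eq.pooled_def prior eq.buyer_eq_value_def)
  \<comment> \<open>The weights \<open>g k\<close> are realised as price lotteries
    \<open>D k\<close> of the individual seller types.\<close>
  have "\<forall>k. \<exists>D. finite (set_pmf D) \<and>
      (\<forall>p\<in>set_pmf D. posted_profit v \<mu> (c k) p = monopoly_profit v \<mu> (c k)) \<and>
      (\<forall>x. measure_pmf.expectation D (net_surplus x) = hinge_sum (range v) (g k) x)"
    using ex_price_pmf[OF opt assms(2)] by (rule allI)
  from choice[OF this] obtain D where D: "\<And>k. finite (set_pmf (D k))"
    "\<And>k p. p \<in> set_pmf (D k) \<Longrightarrow> posted_profit v \<mu> (c k) p = monopoly_profit v \<mu> (c k)"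
    "\<And>k x. measure_pmf.expectation (D k) (net_surplus x) = hinge_sum (range v) (g k) x"
    by blast
  interpret babble: babbling_game M R v c \<mu> \<nu> D
    using assms D by unfold_locales auto
  have "interim_payoff_equivalent R v c \<mu> \<nu> E (babbling v \<mu> \<nu> D)"
    unfolding interim_payoff_equivalent_def seller buyer babble.seller_value_own[OF nil]
      babble.buyer_value_own[OF nil] D(3)
    by (simp add: surplus_def hinge_sum_mixture)
  then show ?thesis
    using babble.babbling_equilibrium all_messages_uninformative_babbling by blast
qed

end
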